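(* Fix $q\in(0,1)$, integers $n_0,n_1\ge1$, put $m=n_0+n_1$, and fix $0<\varepsilon<1/2$ and $1/2<r<1$. Let $H$ be a fair Bernoulli variable. Given $H=h\in\{0,1\}$, generate $n_0$ null $p$-values independently with density $f_h$, where $$f_0(u)=\begin{cases}2(1-\varepsilon),&0<u<1/2,\\ 2\varepsilon,&1/2<u<1,\end{cases}\qquad f_1(u)=f_0(1-u),$$ and generate $n_1$ independent alternative $p$-values, independently of $H$ and of the nulls, with density $$g_r(u)=\begin{cases}2r,&0<u<1/2,\\ 2(1-r),&1/2<u<1.\end{cases}$$ Then the null $p$-values are exactly uniform on $(0,1)$, the joint density of all $m$ $p$-values is strictly positive on $(0,1)^m$, and the full vector is PRDS with respect to the null coordinates. Let $p_0=1-\varepsilon$, $p_1=\varepsilon$, and $k_m=\lceil (m+1)/(1+q)\rceil$. For $h\in\{0,1\}$, let $X_{0,h}\sim\operatorname{Bin}(n_0,p_h)$ and $X_1\sim\operatorname{Bin}(n_1,r)$, independently. Then the mirror threshold at level $q$ satisfies $$\mathrm{FDR}\ge\frac12\sum_{h=0}^1\mathbb E\left[\frac{X_{0,h}}{(X_{0,h}+X_1)\vee1}\mathbf 1\{X_{0,h}+X_1\ge k_m\}\right],$$ $$\mathrm{Power}\ge\frac12\sum_{h=0}^1\mathbb E\left[\frac{X_1}{n_1}\mathbf 1\{X_{0,h}+X_1\ge k_m\}\right].$$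
   Context: $\mathcal H_0$ is the set of null indices and $\mathcal H_1$ the set of alternatives, with $|\mathcal H_1|=n_1$. A vector $P$ is PRDS with respect to the null coordinates if, for every coordinatewise increasing measurable set $D$ and every null index $i$, the map $u\mapsto\mathbb P(P\in D\mid P_i=u)$ is nondecreasing. For $p$-values $P_1,\ldots,P_m$ and $0<u\le1/2$, put $R(u)=\#\{i:P_i\le u\}$, $L(u)=\#\{i:P_i\ge1-u\}$, $\mathcal U=\{\min(P_i,1-P_i):1\le i\le m\}\cap(0,1/2]$. The mirror threshold at level $q$ is $$\widehat u=\max\Big\{u\in\mathcal U:\frac{1+L(u)}{R(u)\vee1}\le q\Big\},$$ with $\widehat u=0$ if the set is empty; the rejection set is $\widehat{\mathcal R}=\{i:P_i\le\widehat u\}$. Here $a\vee b=\max\{a,b\}$. $\mathrm{FDR}=\mathbb E\{|\widehat{\mathcal R}\cap\mathcal H_0|/(|\widehat{\mathcal R}|\vee1)\}$ and $\mathrm{Power}=\mathbb E\{|\widehat{\mathcal R}\cap\mathcal H_1|/n_1\}$. *)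

theory Defs
  imports "HOL-Probability.Probability"
begin

text \<open>Densities of the null and alternative \<open>p\<close>-values. The value \<open>0\<close> at \<open>u = 1/2\<close> is a
  convention: the densities are only determined almost everywhere.\<close>

definition null_density0 :: "real \<Rightarrow> real \<Rightarrow> real" where
  "null_density0 \<epsilon> u =
     (if 0 < u \<and> u < 1/2 then 2 * (1 - \<epsilon>) else if 1/2 < u \<and> u < 1 then 2 * \<epsilon> else 0)"

definition null_density :: "real \<Rightarrow> nat \<Rightarrow> real \<Rightarrow> real" where
  "null_density \<epsilon> h u = (if h = 0 then null_density0 \<epsilon> u else null_density0 \<epsilon> (1 - u))"

definition alt_density :: "real \<Rightarrow> real \<Rightarrow> real" where
  "alt_density r u =
     (if 0 < u \<and> u < 1/2 then 2 * r else if 1/2 < u \<and> u < 1 then 2 * (1 - r) else 0)"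

definition null_prob :: "real \<Rightarrow> nat \<Rightarrow> real" where
  "null_prob \<epsilon> h = (if h = 0 then 1 - \<epsilon> else \<epsilon>)"

text \<open>The conditional probability measure given the (positive probability) event \<open>H = h\<close>.\<close>

definition given_eq :: "'a measure \<Rightarrow> ('a \<Rightarrow> 'b) \<Rightarrow> 'b \<Rightarrow> 'a measure" where
  "given_eq M H h = uniform_measure M (H -` {h} \<inter> space M)"

definition rvec :: "'i set \<Rightarrow> ('i \<Rightarrow> 'a \<Rightarrow> real) \<Rightarrow> 'a \<Rightarrow> 'i \<Rightarrow> real" where
  "rvec I P \<omega> = (\<lambda>i\<in>I. P i \<omega>)"

definition increasing_event :: "'i set \<Rightarrow> ('i \<Rightarrow> real) set \<Rightarrow> bool" where
  "increasing_event I D \<longleftrightarrow>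
     D \<in> sets (Pi\<^sub>M I (\<lambda>_. borel)) \<and>
     (\<forall>x\<in>D. \<forall>y\<in>space (Pi\<^sub>M I (\<lambda>_. borel)). (\<forall>i\<in>I. x i \<le> y i) \<longrightarrow> y \<in> D)"

text \<open>\<open>K\<close> is a regular version of the conditional law of the vector \<open>P\<close> given \<open>P i = u\<close>: a
  probability kernel such that \<open>K u D\<close>, evaluated at \<open>u = P i\<close>, is almost surely the
  conditional expectation of the indicator of \<open>P \<in> D\<close> given the sigma-algebra of \<open>P i\<close>.\<close>

definition cond_law_version ::
    "'a measure \<Rightarrow> 'i set \<Rightarrow> ('i \<Rightarrow> 'a \<Rightarrow> real) \<Rightarrow> 'i \<Rightarrow> (real \<Rightarrow> ('i \<Rightarrow> real) measure) \<Rightarrow> bool" where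
  "cond_law_version M I P i K \<longleftrightarrow>
     K \<in> borel \<rightarrow>\<^sub>M prob_algebra (Pi\<^sub>M I (\<lambda>_. borel)) \<and>
     (\<forall>D\<in>sets (Pi\<^sub>M I (\<lambda>_. borel)).
        AE \<omega> in M. real_cond_exp M (vimage_algebra (space M) (P i) borel)
                     (indicator {\<omega> \<in> space M. rvec I P \<omega> \<in> D}) \<omega>
                   = measure (K (P i \<omega>)) D)"

text \<open>Since the events \<open>P i = u\<close> may be null, \<open>u \<mapsto> Prob (P \<in> D | P i = u)\<close> refers to a version
  of the conditional law; one version has to serve all increasing sets \<open>D\<close> simultaneously.\<close>

definition PRDS :: "'a measure \<Rightarrow> 'i set \<Rightarrow> 'i set \<Rightarrow> ('i \<Rightarrow> 'a \<Rightarrow> real) \<Rightarrow> bool" where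
  "PRDS M I H0 P \<longleftrightarrow>
     (\<forall>i\<in>H0. \<exists>K. cond_law_version M I P i K \<and>
        (\<forall>D. increasing_event I D \<longrightarrow> mono (\<lambda>u. measure (K u) D)))"

definition count_low :: "'i set \<Rightarrow> ('i \<Rightarrow> real) \<Rightarrow> real \<Rightarrow> nat" where
  "count_low I p u = card {i\<in>I. p i \<le> u}"

definition count_high :: "'i set \<Rightarrow> ('i \<Rightarrow> real) \<Rightarrow> real \<Rightarrow> nat" where
  "count_high I p u = card {i\<in>I. p i \<ge> 1 - u}"

definition mirror_candidates :: "'i set \<Rightarrow> ('i \<Rightarrow> real) \<Rightarrow> real set" where
  "mirror_candidates I p = (\<lambda>i. min (p i) (1 - p i)) ` I \<inter> {0<..1/2}"

definition mirror_admissible :: "'i set \<Rightarrow> real \<Rightarrow> ('i \<Rightarrow> real) \<Rightarrow> real set" where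
  "mirror_admissible I q p =
     {u \<in> mirror_candidates I p.
        (1 + real (count_high I p u)) / max (real (count_low I p u)) 1 \<le> q}"

definition mirror_threshold :: "'i set \<Rightarrow> real \<Rightarrow> ('i \<Rightarrow> real) \<Rightarrow> real" where
  "mirror_threshold I q p =
     (if mirror_admissible I q p = {} then 0 else Max (mirror_admissible I q p))"

definition mirror_rejections :: "'i set \<Rightarrow> real \<Rightarrow> ('i \<Rightarrow> real) \<Rightarrow> 'i set" where
  "mirror_rejections I q p = {i\<in>I. p i \<le> mirror_threshold I q p}"

definition FDR :: "'a measure \<Rightarrow> 'i set \<Rightarrow> ('a \<Rightarrow> 'i set) \<Rightarrow> real" where
  "FDR M H0 Rej = (\<integral>\<omega>. real (card (Rej \<omega> \<inter> H0)) / max (real (card (Rej \<omega>))) 1 \<partial>M)"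

definition Power :: "'a measure \<Rightarrow> 'i set \<Rightarrow> ('a \<Rightarrow> 'i set) \<Rightarrow> real" where
  "Power M H1 Rej = (\<integral>\<omega>. real (card (Rej \<omega> \<inter> H1)) / real (card H1) \<partial>M)"

definition crit_count :: "nat \<Rightarrow> real \<Rightarrow> int" where
  "crit_count m q = \<lceil>(real m + 1) / (1 + q)\<rceil>"

text \<open>The joint law of the independent binomial variables \<open>(X\<^sub>0\<^sub>,\<^sub>h, X\<^sub>1)\<close>.\<close>

definition counts_pmf :: "nat \<Rightarrow> nat \<Rightarrow> real \<Rightarrow> real \<Rightarrow> nat \<Rightarrow> (nat \<times> nat) pmf" where
  "counts_pmf n0 n1 \<epsilon> r h = pair_pmf (binomial_pmf n0 (null_prob \<epsilon> h)) (binomial_pmf n1 r)"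

end

theory Submission
  imports Defs
begin

text \<open>Given \<open>P i = u\<close> for a null index \<open>i\<close>, the posterior law of \<open>H\<close> depends only on the side of \<open>1/2\<close> on
  which \<open>u\<close> lies, and it puts more mass on \<open>H = 1\<close> on the upper side. Since the null marginal under
  \<open>H = 1\<close> stochastically dominates the one under \<open>H = 0\<close>, and domination passes to product laws one
  coordinate at a time, the conditional law increases with \<open>u\<close>.

  For the lower bounds, let \<open>S\<close> be the number of \<open>p\<close>-values below \<open>1/2\<close>. At the largest candidate
  \<open>u < 1/2\<close> one has \<open>R u = S\<close> and \<open>L u = m - S\<close>, so this candidate is admissible iff
  \<open>1 + m - S \<le> q S\<close>, i.e. iff \<open>S\<close> reaches the critical count; then exactly the \<open>p\<close>-values below
  \<open>1/2\<close> are rejected, and their numbers among nulls and alternatives are independent binomials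
  given \<open>H\<close>.\<close>

section \<open>Product measures\<close>

text \<open>On a box both the indicator and the density are products over the coordinates, so
  Tonelli factors the integral, and boxes determine a product measure. The hypotheses range over all
  indices because \<open>product_sigma_finite\<close> does.\<close>

lemma PiM_density:
  fixes f :: "'i \<Rightarrow> 'a \<Rightarrow> ennreal"
  assumes I: "finite I"
    and L: "\<And>i. sigma_finite_measure (L i)"
    and f: "\<And>i. f i \<in> borel_measurable (L i)"
    and D: "\<And>i. sigma_finite_measure (density (L i) (f i))"
  shows "Pi\<^sub>M I (\<lambda>i. density (L i) (f i)) = density (Pi\<^sub>M I L) (\<lambda>x. \<Prod>i\<in>I. f i (x i))"
proof -
  interpret L: product_sigma_finite L by (simp add: product_sigma_finite_def L)
  interpret D: product_sigma_finite "\<lambda>i. density (L i) (f i)" by (simp add: product_sigma_finite_def D)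
  note f[measurable]
  show ?thesis
  proof (rule D.PiM_eqI[symmetric, OF I])
    show "sets (density (Pi\<^sub>M I L) (\<lambda>x. \<Prod>i\<in>I. f i (x i))) = sets (Pi\<^sub>M I (\<lambda>i. density (L i) (f i)))"
      by (auto intro!: sets_PiM_cong)
    fix A assume "\<And>i. i \<in> I \<Longrightarrow> A i \<in> sets (density (L i) (f i))"
    then have A[measurable]: "\<And>i. i \<in> I \<Longrightarrow> A i \<in> sets (L i)" by simp
    have [measurable]: "Pi\<^sub>E I A \<in> sets (Pi\<^sub>M I L)" using I A by (intro sets_PiM_I_finite) auto
    have "emeasure (density (Pi\<^sub>M I L) (\<lambda>x. \<Prod>i\<in>I. f i (x i))) (Pi\<^sub>E I A)
      = (\<integral>\<^sup>+x. (\<Prod>i\<in>I. f i (x i)) * indicator (Pi\<^sub>E I A) x \<partial>Pi\<^sub>M I L)"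
      by (intro emeasure_density) measurable
    also have "\<dots> = (\<integral>\<^sup>+x. (\<Prod>i\<in>I. f i (x i) * indicator (A i) (x i)) \<partial>Pi\<^sub>M I L)"
    proof (intro nn_integral_cong)
      fix x assume "x \<in> space (Pi\<^sub>M I L)"
      then have "indicator (Pi\<^sub>E I A) x = (\<Prod>i\<in>I. indicator (A i) (x i) :: ennreal)"
        using I by (auto simp: indicator_def space_PiM PiE_iff prod_zero_iff)
      then show "(\<Prod>i\<in>I. f i (x i)) * indicator (Pi\<^sub>E I A) x = (\<Prod>i\<in>I. f i (x i) * indicator (A i) (x i))"
        by (simp add: prod.distrib)
    qed
    also have "\<dots> = (\<Prod>i\<in>I. \<integral>\<^sup>+u. f i u * indicator (A i) u \<partial>L i)"
      using I by (intro L.product_nn_integral_prod) measurable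
    also have "\<dots> = (\<Prod>i\<in>I. emeasure (density (L i) (f i)) (A i))"
      by (intro prod.cong refl emeasure_density[symmetric]) auto
    finally show "emeasure (density (Pi\<^sub>M I L) (\<lambda>x. \<Prod>i\<in>I. f i (x i))) (Pi\<^sub>E I A)
      = (\<Prod>i\<in>I. emeasure (density (L i) (f i)) (A i))" .
  qed
qed

text \<open>The right side arises from the left by moving the surplus weight \<open>v - w\<close>
  from \<open>a\<close> to the larger \<open>b\<close>. It is applied with
  \<open>w = \<epsilon>\<close> and \<open>v = 1 - \<epsilon>\<close>, both to the null marginals
  and to the posterior weights of \<open>H\<close>.\<close>

lemma ennreal_mix_mono:
  assumes "a \<le> b" and w: "0 \<le> w" "w \<le> v"
  shows "ennreal v * a + ennreal w * b \<le> ennreal w * a + ennreal v * b"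
proof -
  have v: "ennreal v = ennreal w + ennreal (v - w)"
    using w by (subst ennreal_plus[symmetric]) auto
  have "ennreal v * a + ennreal w * b = ennreal w * a + ennreal w * b + ennreal (v - w) * a"
    unfolding v distrib_right by (simp only: ac_simps)
  also have "\<dots> \<le> ennreal w * a + ennreal w * b + ennreal (v - w) * b"
    by (intro add_left_mono mult_left_mono assms) simp
  also have "\<dots> = ennreal w * a + ennreal v * b"
    unfolding v distrib_right by (simp only: ac_simps)
  finally show ?thesis .
qed

text \<open>Stochastic domination tensorises: the laws of the coordinates are exchanged one after
  the other, by induction on \<open>J\<close>. Monotonicity of \<open>f\<close> is asked on
  \<open>extensional J\<close>, where the points of the product space lie.\<close>

lemma nn_integral_PiM_stochastic_mono:
  fixes N N' :: "'i \<Rightarrow> real measure" and f :: "('i \<Rightarrow> real) \<Rightarrow> ennreal"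
  assumes "finite J"
    and N: "\<And>i. prob_space (N i)" "\<And>i. sets (N i) = sets borel"
    and N': "\<And>i. prob_space (N' i)" "\<And>i. sets (N' i) = sets borel"
    and le: "\<And>i g. g \<in> borel_measurable borel \<Longrightarrow> mono g \<Longrightarrow> (\<integral>\<^sup>+u. g u \<partial>N i) \<le> (\<integral>\<^sup>+u. g u \<partial>N' i)"
    and "f \<in> borel_measurable (Pi\<^sub>M J (\<lambda>_. borel))"
    and "\<And>x y. x \<in> extensional J \<Longrightarrow> y \<in> extensional J \<Longrightarrow> (\<And>i. i \<in> J \<Longrightarrow> x i \<le> y i) \<Longrightarrow> f x \<le> f y"
  shows "(\<integral>\<^sup>+x. f x \<partial>Pi\<^sub>M J N) \<le> (\<integral>\<^sup>+x. f x \<partial>Pi\<^sub>M J N')"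
  using assms(1,7,8)
proof (induction J arbitrary: f)
  case empty
  then show ?case by (simp add: PiM_empty)
next
  case (insert i J)
  interpret N: product_prob_space N by (intro product_prob_spaceI N)
  interpret N': product_prob_space N' by (intro product_prob_spaceI N')
  have S: "sets (Pi\<^sub>M K N) = sets (Pi\<^sub>M K (\<lambda>_. borel))"
    "sets (Pi\<^sub>M K N') = sets (Pi\<^sub>M K (\<lambda>_. borel))" for K
    by (auto intro!: sets_PiM_cong N N')
  note [measurable_cong] = S N(2) N'(2)
  note [measurable] = insert.prems(1)
  \<comment> \<open>The new coordinate is integrated out under the dominating law
    \<open>N' i\<close>. Passing to \<open>g\<close> exchanges the law of coordinate
    \<open>i\<close>; the induction hypothesis for \<open>g\<close> then exchanges the
    others.\<close>
  define g where "g x = (\<integral>\<^sup>+y. f (x(i := y)) \<partial>N' i)" for x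
  have upd: "(\<lambda>(x, y). f (x(i := y))) \<in> borel_measurable (Pi\<^sub>M J (\<lambda>_. borel) \<Otimes>\<^sub>M borel)"
    by measurable
  have "sets (Pi\<^sub>M J (\<lambda>_. borel) \<Otimes>\<^sub>M N' i) = sets (Pi\<^sub>M J (\<lambda>_. borel :: real measure) \<Otimes>\<^sub>M borel)"
    by (intro sets_pair_measure_cong N' refl)
  then have "(\<lambda>(x, y). f (x(i := y))) \<in> borel_measurable (Pi\<^sub>M J (\<lambda>_. borel) \<Otimes>\<^sub>M N' i)"
    using upd by (simp cong: measurable_cong_sets)
  then have [measurable]: "g \<in> borel_measurable (Pi\<^sub>M J (\<lambda>_. borel))"
    unfolding g_def using N'.M.sigma_finite_measure_axioms
    by (intro sigma_finite_measure.borel_measurable_nn_integral) auto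
  have mono_coord: "f (x(i := u)) \<le> f (y(i := v))"
    if "x \<in> extensional J" "y \<in> extensional J" "\<And>j. j \<in> J \<Longrightarrow> x j \<le> y j" "u \<le> v" for x y u v
    by (rule insert.prems(2)) (use that insert.hyps in \<open>auto simp: extensional_def\<close>)
  have "(\<integral>\<^sup>+x. f x \<partial>Pi\<^sub>M (insert i J) N) = (\<integral>\<^sup>+x. (\<integral>\<^sup>+y. f (x(i := y)) \<partial>N i) \<partial>Pi\<^sub>M J N)"
    using insert.hyps by (intro N.product_nn_integral_insert) auto
  also have "\<dots> \<le> (\<integral>\<^sup>+x. g x \<partial>Pi\<^sub>M J N)"
  proof (rule nn_integral_mono)
    fix x assume "x \<in> space (Pi\<^sub>M J N)"
    then have x: "x \<in> extensional J" "x \<in> space (Pi\<^sub>M J (\<lambda>_. borel))"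
      by (auto simp: space_PiM PiE_iff)
    show "(\<integral>\<^sup>+y. f (x(i := y)) \<partial>N i) \<le> g x"
      unfolding g_def
    proof (rule le)
      show "(\<lambda>y. f (x(i := y))) \<in> borel_measurable borel"
        using measurable_Pair2[OF upd x(2)] by simp
      show "mono (\<lambda>y. f (x(i := y)))" by (intro monoI mono_coord x order.refl)
    qed
  qed
  also have "\<dots> \<le> (\<integral>\<^sup>+x. g x \<partial>Pi\<^sub>M J N')"
  proof (rule insert.IH)
    show "g x \<le> g y" if "x \<in> extensional J" "y \<in> extensional J" "\<And>i. i \<in> J \<Longrightarrow> x i \<le> y i" for x y
      unfolding g_def by (intro nn_integral_mono mono_coord that order.refl)
  qed measurable
  also have "\<dots> = (\<integral>\<^sup>+x. f x \<partial>Pi\<^sub>M (insert i J) N')"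
    unfolding g_def using insert.hyps by (intro N'.product_nn_integral_insert[symmetric]) auto
  finally show ?case .
qed

text \<open>Outside \<open>A\<close>, \<open>Pi_pmf\<close> takes the value \<open>dflt\<close>
  while points of the product space are \<open>undefined\<close>; \<open>restrict\<close> reconciles
  the two conventions.\<close>

lemma distr_Pi_pmf_restrict:
  assumes "finite A" "A \<noteq> {}"
  shows "distr (measure_pmf (Pi_pmf A dflt p)) (Pi\<^sub>M A (\<lambda>_. count_space UNIV)) (\<lambda>f. restrict f A) =
    Pi\<^sub>M A (\<lambda>i. measure_pmf (p i))"
proof -
  have "distr (measure_pmf (Pi_pmf A dflt p)) (Pi\<^sub>M A (\<lambda>_. count_space UNIV)) (\<lambda>f. \<lambda>i\<in>A. f i) =
      Pi\<^sub>M A (\<lambda>i. distr (measure_pmf (Pi_pmf A dflt p)) (count_space UNIV) (\<lambda>f. f i))"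
    using indep_vars_Pi_pmf[OF assms(1), of dflt p] assms(2)
    by (subst (asm) prob_space.indep_vars_iff_distr_eq_PiM'[OF prob_space_measure_pmf]) auto
  also have "\<dots> = Pi\<^sub>M A (\<lambda>i. measure_pmf (p i))"
    using assms(1) by (intro PiM_cong refl) (simp add: map_pmf_rep_eq[symmetric] Pi_pmf_component)
  finally show ?thesis .
qed

text \<open>The indicators are jointly distributed as independent Bernoulli variables. Moved to
  \<open>Pi_pmf\<close>, this law splits over the disjoint union of \<open>A\<close> and
  \<open>B\<close>, and the number of successes in each block is binomial.\<close>

lemma (in prob_space) distr_counts_indep_indicators:
  fixes X :: "'i \<Rightarrow> 'a \<Rightarrow> bool"
  assumes fin: "finite A" "finite B" and disj: "A \<inter> B = {}" and ne: "A \<union> B \<noteq> {}"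
    and indep: "indep_vars (\<lambda>_. count_space UNIV) X (A \<union> B)"
    and X: "\<And>i. i \<in> A \<Longrightarrow> prob {\<omega>\<in>space M. X i \<omega>} = a" "\<And>i. i \<in> B \<Longrightarrow> prob {\<omega>\<in>space M. X i \<omega>} = b"
    and ab: "a \<in> {0..1}" "b \<in> {0..1}"
  shows "distr M (count_space UNIV) (\<lambda>\<omega>. (card {i\<in>A. X i \<omega>}, card {i\<in>B. X i \<omega>})) =
    measure_pmf (pair_pmf (binomial_pmf (card A) a) (binomial_pmf (card B) b))"
proof -
  let ?C = "\<lambda>f. (card {i\<in>A. f i}, card {i\<in>B. f i})"
  let ?P = "Pi\<^sub>M (A \<union> B) (\<lambda>_. count_space UNIV :: bool measure)"
  define p where "p i = bernoulli_pmf (if i \<in> A then a else b)" for i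
  have Xm[measurable]: "X i \<in> M \<rightarrow>\<^sub>M count_space UNIV" if "i \<in> A \<union> B" for i
    using indep that by (auto simp: indep_vars_def)
  have law: "distr M (count_space UNIV) (X i) = measure_pmf (p i)" if i: "i \<in> A \<union> B" for i
  proof (rule measure_eqI_countable[of _ UNIV])
    fix t :: bool
    interpret D: prob_space "distr M (count_space UNIV) (X i)" by (rule prob_space_distr[OF Xm[OF i]])
    have T: "measure (distr M (count_space UNIV) (X i)) {True} = (if i \<in> A then a else b)"
      using i X disj by (auto simp: measure_distr[OF Xm[OF i]] vimage_def Int_def conj_commute)
    have "{False} = space (distr M (count_space UNIV) (X i)) - {True}" by auto
    then have F: "measure (distr M (count_space UNIV) (X i)) {False} = 1 - (if i \<in> A then a else b)"
      using D.prob_compl[of "{True}"] T by simp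
    show "emeasure (distr M (count_space UNIV) (X i)) {t} = emeasure (measure_pmf (p i)) {t}"
      using T F ab by (cases t) (simp_all add: D.emeasure_eq_measure emeasure_pmf_single p_def)
  qed auto
  \<comment> \<open>A finite product of finite discrete spaces is discrete, so every map out of it
    is measurable.\<close>
  have Cm: "?C \<in> ?P \<rightarrow>\<^sub>M count_space UNIV"
    using fin by (simp add: count_space_PiM_finite)
  have rest: "?C (restrict f (A \<union> B)) = ?C f" for f
    by (auto intro!: arg_cong[where f=card])
  have lawP: "distr M ?P (\<lambda>\<omega>. \<lambda>i\<in>A \<union> B. X i \<omega>) = Pi\<^sub>M (A \<union> B) (\<lambda>i. measure_pmf (p i))"
  proof -
    have "distr M ?P (\<lambda>\<omega>. \<lambda>i\<in>A \<union> B. X i \<omega>) = Pi\<^sub>M (A \<union> B) (\<lambda>i. distr M (count_space UNIV) (X i))"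
      using indep ne by (subst (asm) indep_vars_iff_distr_eq_PiM') auto
    also have "\<dots> = Pi\<^sub>M (A \<union> B) (\<lambda>i. measure_pmf (p i))" by (intro PiM_cong refl law)
    finally show ?thesis .
  qed
  let ?Q = "Pi_pmf (A \<union> B) False p"
  have "distr M (count_space UNIV) (\<lambda>\<omega>. ?C (\<lambda>i. X i \<omega>)) =
      distr (distr M ?P (\<lambda>\<omega>. \<lambda>i\<in>A \<union> B. X i \<omega>)) (count_space UNIV) ?C"
    using measurable_restrict[of "A \<union> B" X M "\<lambda>_. count_space UNIV", OF Xm]
    by (subst distr_distr[OF Cm]) (simp_all only: comp_def rest)
  also have "\<dots> = distr (distr (measure_pmf ?Q) ?P (\<lambda>f. restrict f (A \<union> B))) (count_space UNIV) ?C"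
    unfolding lawP using fin ne by (subst distr_Pi_pmf_restrict) auto
  also have "\<dots> = distr (measure_pmf ?Q) (count_space UNIV) ?C"
    by (subst distr_distr[OF Cm]) (simp add: space_PiM, simp only: comp_def rest)
  also have "\<dots> = measure_pmf (map_pmf ?C ?Q)" by (simp add: map_pmf_rep_eq)
  also have "map_pmf ?C ?Q = pair_pmf (binomial_pmf (card A) a) (binomial_pmf (card B) b)"
  proof -
    have "map_pmf ?C ?Q = map_pmf (\<lambda>(f, g). (card {i\<in>A. f i}, card {i\<in>B. g i}))
        (pair_pmf (Pi_pmf A False p) (Pi_pmf B False p))"
      unfolding Pi_pmf_union[OF fin disj] map_pmf_comp using disj
      by (intro map_pmf_cong refl) (auto intro!: arg_cong[where f=card])
    also have "\<dots> = pair_pmf (map_pmf (\<lambda>f. card {i\<in>A. f i}) (Pi_pmf A False (\<lambda>_. bernoulli_pmf a)))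
        (map_pmf (\<lambda>f. card {i\<in>B. f i}) (Pi_pmf B False (\<lambda>_. bernoulli_pmf b)))"
    proof -
      have "Pi_pmf A False p = Pi_pmf A False (\<lambda>_. bernoulli_pmf a)"
        "Pi_pmf B False p = Pi_pmf B False (\<lambda>_. bernoulli_pmf b)"
        using fin disj by (auto intro!: Pi_pmf_cong simp: p_def)
      then show ?thesis by (simp add: map_pair)
    qed
    also have "\<dots> = pair_pmf (binomial_pmf (card A) a) (binomial_pmf (card B) b)"
      using fin ab by (simp add: binomial_pmf_altdef'[symmetric])
    finally show ?thesis .
  qed
  finally show ?thesis .
qed

section \<open>The mirror threshold\<close>

text \<open>Excluding the value \<open>1/2\<close> keeps every candidate strictly below
  \<open>1/2\<close>, so that no p-value counts both as low and as high at a candidate.\<close>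

lemma mirror_rejections_eq_low:
  assumes I: "finite I" and q: "0 < q"
    and p: "\<And>i. i \<in> I \<Longrightarrow> 0 < p i \<and> p i < 1 \<and> p i \<noteq> 1/2"
    and S: "int (card {i\<in>I. p i < 1/2}) \<ge> crit_count (card I) q"
  shows "mirror_rejections I q p = {i\<in>I. p i < 1/2}"
proof -
  let ?S = "{i\<in>I. p i < 1/2}"
  let ?U = "mirror_candidates I p"
  have "(real (card I) + 1) / (1 + q) \<le> real_of_int (int (card ?S))"
    using S unfolding crit_count_def by (simp only: ceiling_le_iff)
  \<comment> \<open>With \<open>m = card I\<close> and \<open>S = card ?S\<close> this rearranges to
    \<open>1 + (m - S) \<le> q * S\<close>, the admissibility of a candidate at which
    \<open>S\<close> p-values are low and all others are high.\<close>
  then have key: "real (card I) + 1 \<le> card ?S * (1 + q)"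
    using q by (simp add: pos_divide_le_eq)
  have "card ?S \<noteq> 0"
  proof
    assume "card ?S = 0"
    then have "real (card I) + 1 \<le> 0" using key by simp
    then show False by simp
  qed
  then have pos: "0 < card ?S" by simp
  then have "I \<noteq> {}" using card_gt_0_iff by fastforce
  have finU: "finite ?U" using I by (simp add: mirror_candidates_def)
  have inU: "min (p i) (1 - p i) \<in> ?U" if "i \<in> I" for i
    using p[OF that] that by (auto simp: mirror_candidates_def min_def)
  have U_low: "u < 1/2" if "u \<in> ?U" for u
    using that p by (auto simp: mirror_candidates_def min_def) (smt (verit) p field_sum_of_halves)+
  define v where "v = Max ?U"
  have vU: "v \<in> ?U" unfolding v_def using finU inU \<open>I \<noteq> {}\<close> by (intro Max_in) auto
  have le_v: "min (p i) (1 - p i) \<le> v" if "i \<in> I" for i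
    unfolding v_def using finU inU[OF that] by (rule Max_ge)
  \<comment> \<open>By maximality of \<open>v\<close>, each p-value or its reflection is at most
    \<open>v\<close>. No p-value lies strictly between \<open>v\<close> and \<open>1 - v\<close>, so
    the counts at \<open>v\<close> are those below and above \<open>1/2\<close>.\<close>
  have low: "p i \<le> v \<longleftrightarrow> p i < 1/2" if "i \<in> I" for i
    using le_v[OF that] U_low[OF vU] by (auto simp: min_def split: if_splits)
  have high: "p i \<ge> 1 - v \<longleftrightarrow> \<not> p i < 1/2" if "i \<in> I" for i
    using le_v[OF that] U_low[OF vU] p[OF that] by (auto simp: min_def split: if_splits)
  have cl: "count_low I p v = card ?S"
    unfolding count_low_def using low by (intro arg_cong[where f=card]) auto
  have "{i\<in>I. p i \<ge> 1 - v} = I - ?S" using high by auto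
  then have ch: "count_high I p v = card I - card ?S"
    unfolding count_high_def using I by (simp add: card_Diff_subset)
  have "card ?S \<le> card I" using I by (intro card_mono) auto
  moreover have "max (real (card ?S)) 1 = card ?S" using pos by simp
  ultimately have "(1 + real (count_high I p v)) / max (real (count_low I p v)) 1 \<le> q"
    using key pos by (simp add: cl ch pos_divide_le_eq of_nat_diff algebra_simps)
  then have vA: "v \<in> mirror_admissible I q p"
    using vU by (simp add: mirror_admissible_def)
  have "Max (mirror_admissible I q p) = v"
  proof (rule Max_eqI[OF _ _ vA])
    show "finite (mirror_admissible I q p)" using finU by (simp add: mirror_admissible_def)
    show "y \<le> v" if "y \<in> mirror_admissible I q p" for y
      using that finU by (simp add: mirror_admissible_def v_def)
  qed
  then have "mirror_threshold I q p = v"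
    using vA by (auto simp: mirror_threshold_def)
  then show ?thesis unfolding mirror_rejections_def using low by auto
qed

text \<open>The maximum of a random finite set is at least \<open>P i\<close> iff one of its members
  is. Rejection thus becomes a finite Boolean combination of measurable conditions indexed by
  \<open>I\<close>.\<close>

lemma measurable_mirror_rejections:
  fixes P :: "'i \<Rightarrow> 'a \<Rightarrow> real"
  assumes I: "finite I" and P[measurable]: "\<And>i. i \<in> I \<Longrightarrow> P i \<in> borel_measurable M" and i: "i \<in> I"
  shows "Measurable.pred M (\<lambda>\<omega>. i \<in> mirror_rejections I q (\<lambda>i. P i \<omega>))"
proof -
  define u where "u j \<omega> = min (P j \<omega>) (1 - P j \<omega>)" for j \<omega>
  define adm where "adm j \<omega> \<longleftrightarrow> 0 < u j \<omega> \<and> u j \<omega> \<le> 1/2 \<and>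
      (1 + (\<Sum>k\<in>I. of_bool (P k \<omega> \<ge> 1 - u j \<omega>))) / max (\<Sum>k\<in>I. of_bool (P k \<omega> \<le> u j \<omega>)) 1 \<le> q"
    for j \<omega>
  have [measurable]: "Measurable.pred M (adm j)" if "j \<in> I" for j
    using that unfolding adm_def u_def of_bool_def by measurable
  have card: "real (card {k\<in>I. Q k}) = (\<Sum>k\<in>I. of_bool (Q k))" for Q
    using I by (simp add: sum.If_cases of_bool_def Int_def)
  have adm: "mirror_admissible I q (\<lambda>i. P i \<omega>) = {u j \<omega> |j. j \<in> I \<and> adm j \<omega>}" for \<omega>
    unfolding mirror_admissible_def mirror_candidates_def count_low_def count_high_def card
    by (auto simp: adm_def u_def)
  \<comment> \<open>The first alternative reflects the default threshold \<open>0\<close>: with no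
    admissible candidate, only p-values at most \<open>0\<close> are rejected.\<close>
  have "i \<in> mirror_rejections I q (\<lambda>i. P i \<omega>) \<longleftrightarrow>
      ((\<forall>j\<in>I. \<not> adm j \<omega>) \<and> P i \<omega> \<le> 0) \<or> (\<exists>j\<in>I. adm j \<omega> \<and> P i \<omega> \<le> u j \<omega>)" for \<omega>
  proof (cases "\<forall>j\<in>I. \<not> adm j \<omega>")
    case True
    then have "mirror_admissible I q (\<lambda>i. P i \<omega>) = {}" unfolding adm by blast
    then show ?thesis using True i by (auto simp: mirror_rejections_def mirror_threshold_def)
  next
    case False
    then have ne: "mirror_admissible I q (\<lambda>i. P i \<omega>) \<noteq> {}" unfolding adm by blast
    have "finite (mirror_admissible I q (\<lambda>i. P i \<omega>))"
      using I by (simp add: mirror_admissible_def mirror_candidates_def)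
    then have "P i \<omega> \<le> Max (mirror_admissible I q (\<lambda>i. P i \<omega>)) \<longleftrightarrow>
        (\<exists>j\<in>I. adm j \<omega> \<and> P i \<omega> \<le> u j \<omega>)"
      using ne by (subst Max_ge_iff) (auto simp: adm)
    then show ?thesis using False ne i by (auto simp: mirror_rejections_def mirror_threshold_def)
  qed
  moreover have "Measurable.pred M (\<lambda>\<omega>. ((\<forall>j\<in>I. \<not> adm j \<omega>) \<and> P i \<omega> \<le> 0) \<or>
      (\<exists>j\<in>I. adm j \<omega> \<and> P i \<omega> \<le> u j \<omega>))"
    using i I unfolding u_def by measurable
  ultimately show ?thesis by simp
qed

lemma measurable_card_rejections:
  fixes Rej :: "'a \<Rightarrow> 'i set"
  assumes "finite I" "\<And>\<omega>. Rej \<omega> \<subseteq> I" "\<And>i. i \<in> I \<Longrightarrow> Measurable.pred M (\<lambda>\<omega>. i \<in> Rej \<omega>)"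
  shows "(\<lambda>\<omega>. real (card (Rej \<omega> \<inter> J))) \<in> borel_measurable M"
proof -
  note assms(3)[measurable]
  have "real (card (Rej \<omega> \<inter> J)) = (\<Sum>i\<in>I. if i \<in> J \<and> i \<in> Rej \<omega> then 1 else 0)" for \<omega>
  proof -
    have "Rej \<omega> \<inter> J = {i\<in>I. i \<in> J \<and> i \<in> Rej \<omega>}" using assms(2) by auto
    then show ?thesis using assms(1) by (simp add: sum.If_cases Int_def)
  qed
  moreover have "(\<lambda>\<omega>. \<Sum>i\<in>I. if i \<in> J \<and> i \<in> Rej \<omega> then 1 else 0 :: real) \<in> borel_measurable M"
    by measurable
  ultimately show ?thesis by simp
qed

section \<open>The mixture model\<close>

text \<open>The locale carries the model of the final theorem without the level \<open>q\<close>,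
  which enters only in a later context. The sizes of the index sets are replaced by their
  nonemptiness.\<close>

locale mirror_model = prob_space M
  for M :: "'a measure" and H :: "'a \<Rightarrow> nat" and P :: "'i \<Rightarrow> 'a \<Rightarrow> real"
    and H0 H1 :: "'i set" and \<epsilon> r :: real +
  assumes eps: "0 < \<epsilon>" "\<epsilon> < 1/2"
    and r: "1/2 < r" "r < 1"
    and fin: "finite H0" "finite H1" and disj: "H0 \<inter> H1 = {}" and nonempty: "H0 \<noteq> {}" "H1 \<noteq> {}"
    and H_meas[measurable]: "H \<in> M \<rightarrow>\<^sub>M count_space UNIV"
    and H_law: "distr M (count_space UNIV) H = measure_pmf (map_pmf of_bool (bernoulli_pmf (1/2)))"
    and indep: "\<And>h. h \<in> {0, 1} \<Longrightarrow>
                  prob_space.indep_vars (given_eq M H h) (\<lambda>_. borel) P (H0 \<union> H1)"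
    and nulls: "\<And>h i. h \<in> {0, 1} \<Longrightarrow> i \<in> H0 \<Longrightarrow>
                  distributed (given_eq M H h) lborel (P i) (\<lambda>u. ennreal (null_density \<epsilon> h u))"
    and alts: "\<And>h i. h \<in> {0, 1} \<Longrightarrow> i \<in> H1 \<Longrightarrow>
                  distributed (given_eq M H h) lborel (P i) (\<lambda>u. ennreal (alt_density r u))"
begin

abbreviation "I \<equiv> H0 \<union> H1"

abbreviation "cond \<equiv> given_eq M H"

text \<open>Every index outside \<open>H0\<close>, even outside \<open>I\<close>, receives the
  alternative density, so that the marginals are probability measures at all indices, as the product
  measure locales demand.\<close>

definition dens :: "nat \<Rightarrow> 'i \<Rightarrow> real \<Rightarrow> real" where
  "dens h i = (if i \<in> H0 then null_density \<epsilon> h else alt_density r)"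

definition marginal :: "nat \<Rightarrow> 'i \<Rightarrow> real measure" where
  "marginal h i = density lborel (\<lambda>u. ennreal (dens h i u))"

section \<open>Conditioning on the hidden variable \<open>H\<close>\<close>

lemma finite_I: "finite I" using fin by simp

lemma sets_cond[simp, measurable_cong]: "sets (cond h) = sets M"
  and space_cond[simp]: "space (cond h) = space M"
  by (simp_all add: given_eq_def)

lemma emeasure_H:
  assumes "h \<in> {0, 1}"
  shows "emeasure M (H -` {h} \<inter> space M) = ennreal (1/2)"
proof -
  have vim: "(of_bool :: bool \<Rightarrow> nat) -` {0} = {False}" "(of_bool :: bool \<Rightarrow> nat) -` {Suc 0} = {True}"
    by (auto simp: of_bool_def split: if_splits)
  have "emeasure M (H -` {h} \<inter> space M) = emeasure (distr M (count_space UNIV) H) {h}"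
    by (simp add: emeasure_distr)
  also have "\<dots> = ennreal (pmf (map_pmf of_bool (bernoulli_pmf (1/2))) h)"
    by (simp add: H_law emeasure_pmf_single)
  also have "pmf (map_pmf of_bool (bernoulli_pmf (1/2))) h = 1/2"
    using assms by (auto simp: pmf_map vim measure_pmf_single)
  finally show ?thesis .
qed

lemma prob_space_cond: "h \<in> {0, 1} \<Longrightarrow> prob_space (cond h)"
  unfolding given_eq_def by (rule prob_space_uniform_measure) (simp_all add: emeasure_H)

text \<open>Law of total expectation. Almost surely \<open>H\<close> is \<open>0\<close> or
  \<open>1\<close>, each of the two events has mass \<open>1/2\<close>, and multiplying by this mass
  undoes the normalisation in \<open>given_eq\<close>.\<close>

lemma nn_integral_mixture:
  assumes [measurable]: "f \<in> borel_measurable M"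
  shows "(\<integral>\<^sup>+\<omega>. f \<omega> \<partial>M) =
    ennreal (1/2) * (\<integral>\<^sup>+\<omega>. f \<omega> \<partial>cond 0) + ennreal (1/2) * (\<integral>\<^sup>+\<omega>. f \<omega> \<partial>cond 1)"
proof -
  let ?A = "\<lambda>h. H -` {h} \<inter> space M"
  have [measurable]: "?A h \<in> sets M" for h by (rule measurable_sets[OF H_meas]) simp
  have half: "ennreal (1/2) * (x / ennreal (1/2)) = x" for x
    by (simp add: ennreal_times_divide mult_divide_eq_ennreal mult.commute)
  have c: "ennreal (1/2) * (\<integral>\<^sup>+\<omega>. f \<omega> \<partial>cond h) = (\<integral>\<^sup>+\<omega>. f \<omega> * indicator (?A h) \<omega> \<partial>M)"
    if "h \<in> {0, 1}" for h
    unfolding given_eq_def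
    by (subst nn_integral_uniform_measure) (simp_all only: emeasure_H[OF that] half, measurable)
  have "AE x in distr M (count_space UNIV) H. x \<in> {0, 1}"
    unfolding H_law by (auto simp: AE_measure_pmf_iff)
  then have ae: "AE \<omega> in M. H \<omega> \<in> {0, 1}"
    by (subst (asm) AE_distr_iff) auto
  have "(\<integral>\<^sup>+\<omega>. f \<omega> \<partial>M) = (\<integral>\<^sup>+\<omega>. f \<omega> * indicator (?A 0) \<omega> + f \<omega> * indicator (?A 1) \<omega> \<partial>M)"
    by (intro nn_integral_cong_AE) (use ae AE_space in \<open>eventually_elim; auto simp: indicator_def\<close>)
  also have "\<dots> = (\<integral>\<^sup>+\<omega>. f \<omega> * indicator (?A 0) \<omega> \<partial>M) + (\<integral>\<^sup>+\<omega>. f \<omega> * indicator (?A 1) \<omega> \<partial>M)"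
    by (intro nn_integral_add) measurable
  finally show ?thesis using c[of 0] c[of 1] by simp
qed

lemma emeasure_mixture:
  assumes "A \<in> sets M"
  shows "emeasure M A = ennreal (1/2) * emeasure (cond 0) A + ennreal (1/2) * emeasure (cond 1) A"
  using nn_integral_mixture[of "indicator A"] assms by simp

section \<open>Laws of the p-values given \<open>H\<close>\<close>

lemma borel_measurable_null_density[measurable]: "null_density \<epsilon> h \<in> borel_measurable borel"
  unfolding null_density_def[abs_def] null_density0_def[abs_def] by measurable

lemma borel_measurable_alt_density[measurable]: "alt_density r \<in> borel_measurable borel"
  unfolding alt_density_def[abs_def] by measurable

lemma borel_measurable_dens[measurable]: "dens h i \<in> borel_measurable borel"
  unfolding dens_def by (cases "i \<in> H0") simp_all

lemma P_meas[measurable]: "i \<in> I \<Longrightarrow> P i \<in> borel_measurable M"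
  using distributed_measurable[OF nulls[of 0 i]] distributed_measurable[OF alts[of 0 i]]
  by (auto simp: measurable_def)

lemma rvec_meas[measurable]: "J \<subseteq> I \<Longrightarrow> rvec J P \<in> M \<rightarrow>\<^sub>M Pi\<^sub>M J (\<lambda>_. borel)"
  unfolding rvec_def[abs_def] by (intro measurable_restrict P_meas) auto

lemma sets_marginal[simp, measurable_cong]: "sets (marginal h i) = sets borel"
  by (simp add: marginal_def)

lemma sets_PiM_marginal[measurable_cong]: "sets (Pi\<^sub>M J (marginal h)) = sets (Pi\<^sub>M J (\<lambda>_. borel))"
  by (intro sets_PiM_cong) simp_all

lemma distr_P:
  assumes "h \<in> {0, 1}" "i \<in> I"
  shows "distr (cond h) borel (P i) = marginal h i"
proof -
  have "distr (cond h) borel (P i) = distr (cond h) lborel (P i)"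
    by (intro distr_cong) simp_all
  also have "\<dots> = marginal h i"
    using assms disj distributed_distr_eq_density[OF nulls[of h i]]
      distributed_distr_eq_density[OF alts[of h i]]
    by (auto simp: marginal_def dens_def)
  finally show ?thesis .
qed

text \<open>Each density is that of some p-value: an index of \<open>H0\<close> serves for itself,
  and every other index borrows an element of \<open>H1\<close>. No integral of a density has to be
  computed.\<close>

lemma prob_space_marginal:
  assumes h: "h \<in> {0, 1}"
  shows "prob_space (marginal h i)"
proof -
  obtain k where "k \<in> H1" using nonempty by auto
  define j where "j = (if i \<in> H0 then i else k)"
  have j: "j \<in> I" "dens h i = dens h j"
    using \<open>k \<in> H1\<close> disj by (auto simp: j_def dens_def)
  interpret C: prob_space "cond h" by (rule prob_space_cond[OF h])
  have "prob_space (distr (cond h) borel (P j))"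
    using j by (intro C.prob_space_distr) simp
  then show ?thesis using j distr_P[OF h j(1)] by (simp add: marginal_def)
qed

lemma product_prob_space_marginal: "h \<in> {0, 1} \<Longrightarrow> product_prob_space (marginal h)"
  by (intro product_prob_spaceI prob_space_marginal)

lemma distr_rvec:
  assumes h: "h \<in> {0, 1}"
  shows "distr (cond h) (Pi\<^sub>M I (\<lambda>_. borel)) (rvec I P) = Pi\<^sub>M I (marginal h)"
proof -
  interpret C: prob_space "cond h" by (rule prob_space_cond[OF h])
  have "distr (cond h) (Pi\<^sub>M I (\<lambda>_. borel)) (\<lambda>\<omega>. \<lambda>i\<in>I. P i \<omega>)
      = Pi\<^sub>M I (\<lambda>i. distr (cond h) borel (P i))"
    using indep[OF h] nonempty
    by (subst (asm) C.indep_vars_iff_distr_eq_PiM') (auto intro: P_meas)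
  also have "\<dots> = Pi\<^sub>M I (marginal h)"
    by (intro PiM_cong refl distr_P h)
  finally show ?thesis unfolding rvec_def[abs_def] .
qed

lemma measurable_fun_upd_index:
  assumes i: "i \<in> I"
  shows "(\<lambda>(u, x). x(i := u)) \<in> borel \<Otimes>\<^sub>M Pi\<^sub>M (I - {i}) (\<lambda>_. borel) \<rightarrow>\<^sub>M Pi\<^sub>M I (\<lambda>_. borel :: real measure)"
proof -
  have ins: "insert i (I - {i}) = I" using i by auto
  have "(\<lambda>(u, x). x(i := u)) \<in> borel \<Otimes>\<^sub>M Pi\<^sub>M (I - {i}) (\<lambda>_. borel) \<rightarrow>\<^sub>M Pi\<^sub>M (insert i (I - {i})) (\<lambda>_. borel :: real measure)"
    by measurable
  then show ?thesis unfolding ins .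
qed

lemma borel_measurable_section:
  assumes h: "h \<in> {0, 1}" and i: "i \<in> I" and f: "f \<in> borel_measurable (Pi\<^sub>M I (\<lambda>_. borel))"
  shows "(\<lambda>u. \<integral>\<^sup>+x. f (x(i := u)) \<partial>Pi\<^sub>M (I - {i}) (marginal h)) \<in> borel_measurable borel"
proof -
  have "(\<lambda>(u, x). f (x(i := u))) \<in> borel_measurable (borel \<Otimes>\<^sub>M Pi\<^sub>M (I - {i}) (\<lambda>_. borel))"
    using measurable_compose[OF measurable_fun_upd_index[OF i] f] by (simp add: case_prod_unfold)
  moreover have "sets (borel \<Otimes>\<^sub>M Pi\<^sub>M (I - {i}) (marginal h)) =
      sets (borel \<Otimes>\<^sub>M Pi\<^sub>M (I - {i}) (\<lambda>_. borel :: real measure))"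
    by (intro sets_pair_measure_cong sets_PiM_marginal refl)
  ultimately have "(\<lambda>(u, x). f (x(i := u))) \<in> borel_measurable (borel \<Otimes>\<^sub>M Pi\<^sub>M (I - {i}) (marginal h))"
    by (simp cong: measurable_cong_sets)
  then show ?thesis
    using prob_space_PiM[of "I - {i}" "marginal h"] prob_space_marginal[OF h]
    by (intro sigma_finite_measure.borel_measurable_nn_integral)
      (auto simp: prob_space_imp_sigma_finite)
qed

text \<open>Fubini for the product law given \<open>H = h\<close>, with \<open>P i\<close>
  integrated last. Both the law of the remaining coordinates and the conditional expectations are
  computed through it.\<close>

lemma nn_integral_rvec_null:
  assumes h: "h \<in> {0, 1}" and i: "i \<in> H0"
    and f[measurable]: "f \<in> borel_measurable (Pi\<^sub>M I (\<lambda>_. borel))"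
  shows "(\<integral>\<^sup>+\<omega>. f (rvec I P \<omega>) \<partial>cond h) =
    (\<integral>\<^sup>+u. ennreal (null_density \<epsilon> h u) * (\<integral>\<^sup>+x. f (x(i := u)) \<partial>Pi\<^sub>M (I - {i}) (marginal h)) \<partial>lborel)"
proof -
  interpret product_prob_space "marginal h" I by (rule product_prob_space_marginal[OF h])
  have ins: "insert i (I - {i}) = I" using i by auto
  have f': "f \<in> borel_measurable (Pi\<^sub>M (insert i (I - {i})) (\<lambda>_. borel))" unfolding ins by fact
  note [measurable] = borel_measurable_section[OF h _ f, of i]
  have "(\<integral>\<^sup>+\<omega>. f (rvec I P \<omega>) \<partial>cond h) = (\<integral>\<^sup>+x. f x \<partial>distr (cond h) (Pi\<^sub>M I (\<lambda>_. borel)) (rvec I P))"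
    by (intro nn_integral_distr[symmetric]) measurable
  also have "\<dots> = (\<integral>\<^sup>+x. f x \<partial>Pi\<^sub>M (insert i (I - {i})) (marginal h))"
    by (simp only: distr_rvec[OF h] ins)
  also have "\<dots> = (\<integral>\<^sup>+u. (\<integral>\<^sup>+x. f (x(i := u)) \<partial>Pi\<^sub>M (I - {i}) (marginal h)) \<partial>marginal h i)"
    using finite_I f' by (intro product_nn_integral_insert_rev) auto
  also have "\<dots> = (\<integral>\<^sup>+u. ennreal (null_density \<epsilon> h u) * (\<integral>\<^sup>+x. f (x(i := u)) \<partial>Pi\<^sub>M (I - {i}) (marginal h)) \<partial>lborel)"
    unfolding marginal_def[of h i] using i by (subst nn_integral_density) (auto simp: dens_def borel_measurable_section[OF h _ f])
  finally show ?thesis .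
qed

text \<open>Averaging over the fair \<open>H\<close> gives
  \<open>(1 - \<epsilon>) + \<epsilon> = 1\<close> on each half of \<open>(0,1)\<close>. The point
  \<open>1/2\<close>, where both null densities vanish, is negligible.\<close>

lemma distr_null_uniform:
  assumes i: "i \<in> H0"
  shows "distr M lborel (P i) = uniform_measure lborel {0<..<1}"
proof (rule measure_eqI)
  fix A assume "A \<in> sets (distr M lborel (P i))"
  then have [measurable]: "A \<in> sets borel" by simp
  have [simp, measurable]: "P i \<in> borel_measurable M" using P_meas i by simp
  have c: "emeasure (cond h) (P i -` A \<inter> space M) =
      (\<integral>\<^sup>+u. ennreal (null_density \<epsilon> h u) * indicator A u \<partial>lborel)" if "h \<in> {0, 1}" for h
    using arg_cong[OF distributed_distr_eq_density[OF nulls[OF that i]], of "\<lambda>N. emeasure N A"]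
    using P_meas[of i] i by (simp add: emeasure_distr emeasure_density measurable_cong_sets[OF sets_cond refl])
  have "emeasure (distr M lborel (P i)) A = emeasure M (P i -` A \<inter> space M)"
    by (rule emeasure_distr) simp_all
  also have "\<dots> = (\<integral>\<^sup>+u. ennreal (1/2) * (ennreal (null_density \<epsilon> 0 u) * indicator A u) +
      ennreal (1/2) * (ennreal (null_density \<epsilon> 1 u) * indicator A u) \<partial>lborel)"
    by (subst emeasure_mixture) (simp_all add: c nn_integral_add nn_integral_cmult)
  also have "\<dots> = (\<integral>\<^sup>+u. indicator ({0<..<1} \<inter> A) u \<partial>lborel)"
  proof (rule nn_integral_cong_AE)
    show "AE u in lborel. ennreal (1/2) * (ennreal (null_density \<epsilon> 0 u) * indicator A u) +
      ennreal (1/2) * (ennreal (null_density \<epsilon> 1 u) * indicator A u) = indicator ({0<..<1} \<inter> A) u"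
      using AE_lborel_singleton[of "1/2"]
    proof eventually_elim
      case (elim u)
      then show ?case using eps
        by (auto simp: null_density_def null_density0_def indicator_def ennreal_mult[symmetric]
            ennreal_plus[symmetric] diff_divide_distrib simp del: ennreal_plus ennreal_half)
    qed
  qed
  finally show "emeasure (distr M lborel (P i)) A = emeasure (uniform_measure lborel {0<..<1}) A"
    by (simp add: divide_ennreal_def)
qed simp

text \<open>The given densities vanish at \<open>1/2\<close>; changing them at this null point makes the joint density
  strictly positive.\<close>

definition pos_dens :: "nat \<Rightarrow> 'i \<Rightarrow> real \<Rightarrow> real" where
  "pos_dens h i u = (if u = 1/2 then 1 else dens h i u)"

lemma pos_dens_pos: "0 < u \<Longrightarrow> u < 1 \<Longrightarrow> 0 < pos_dens h i u"
  using eps r by (auto simp: pos_dens_def dens_def null_density_def null_density0_def alt_density_def)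

lemma pos_dens_nonneg: "0 \<le> pos_dens h i u"
  using eps r by (auto simp: pos_dens_def dens_def null_density_def null_density0_def alt_density_def)

lemma borel_measurable_pos_dens[measurable]: "pos_dens h i \<in> borel_measurable borel"
  unfolding pos_dens_def[abs_def] by measurable

lemma marginal_pos_dens: "marginal h i = density lborel (\<lambda>u. ennreal (pos_dens h i u))"
  unfolding marginal_def
proof (rule density_cong)
  show "AE u in lborel. ennreal (dens h i u) = ennreal (pos_dens h i u)"
    using AE_lborel_singleton[of "1/2"] by eventually_elim (simp add: pos_dens_def)
qed simp_all

text \<open>The law of the vector is a mixture of two product laws, so the average of two product
  densities serves as its density. Each product is positive on the open cube because its factors
  are.\<close>

lemma distributed_joint_positive:
  "\<exists>\<phi>. distributed M (Pi\<^sub>M I (\<lambda>_. lborel)) (rvec I P) (\<lambda>x. ennreal (\<phi> x)) \<and>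
     (\<forall>x\<in>I \<rightarrow>\<^sub>E {0<..<1}. 0 < \<phi> x)"
proof (intro exI conjI ballI)
  define \<psi> where "\<psi> h x = (\<Prod>i\<in>I. pos_dens h i (x i))" for h x
  define \<phi> where "\<phi> x = 1/2 * \<psi> 0 x + 1/2 * \<psi> 1 x" for x
  have \<psi>_nonneg: "0 \<le> \<psi> h x" for h x
    unfolding \<psi>_def by (intro prod_nonneg pos_dens_nonneg ballI)
  have ennreal_\<phi>: "ennreal (\<phi> x) = ennreal (1/2) * ennreal (\<psi> 0 x) + ennreal (1/2) * ennreal (\<psi> 1 x)" for x
    unfolding \<phi>_def using \<psi>_nonneg by (subst ennreal_plus) (auto simp: ennreal_mult'[symmetric] simp del: ennreal_half)
  show "0 < \<phi> x" if "x \<in> I \<rightarrow>\<^sub>E {0<..<1}" for x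
  proof -
    have "0 < \<psi> h x" for h
      unfolding \<psi>_def using that by (intro prod_pos pos_dens_pos ballI) (auto simp: PiE_iff)
    then show ?thesis by (simp add: \<phi>_def add_pos_pos)
  qed
  let ?L = "Pi\<^sub>M I (\<lambda>_. lborel :: real measure)"
  have setsL: "sets ?L = sets (Pi\<^sub>M I (\<lambda>_. borel))" by (intro sets_PiM_cong) simp_all
  have [measurable]: "\<psi> h \<in> borel_measurable ?L" for h unfolding \<psi>_def[abs_def] by measurable
  have [measurable]: "rvec I P \<in> M \<rightarrow>\<^sub>M ?L"
    using rvec_meas[OF order.refl] by (simp cong: measurable_cong_sets add: setsL)
  have dens: "Pi\<^sub>M I (marginal h) = density ?L (\<lambda>x. ennreal (\<psi> h x))" if h: "h \<in> {0, 1}" for h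
  proof -
    have "Pi\<^sub>M I (marginal h) = density ?L (\<lambda>x. \<Prod>i\<in>I. ennreal (pos_dens h i (x i)))"
      unfolding marginal_pos_dens[abs_def]
    proof (rule PiM_density[OF finite_I])
      show "sigma_finite_measure (density lborel (\<lambda>u. ennreal (pos_dens h i u)))" for i
        using prob_space_marginal[OF h, of i]
        by (simp add: marginal_pos_dens prob_space_imp_sigma_finite)
    qed (simp_all add: lborel.sigma_finite_measure_axioms)
    then show ?thesis by (simp add: \<psi>_def prod_ennreal pos_dens_nonneg)
  qed
  show "distributed M ?L (rvec I P) (\<lambda>x. ennreal (\<phi> x))"
    unfolding distributed_def
  proof (intro conjI)
    show "distr M ?L (rvec I P) = density ?L (\<lambda>x. ennreal (\<phi> x))"
    proof (rule measure_eqI)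
      fix A assume "A \<in> sets (distr M ?L (rvec I P))"
      then have [measurable]: "A \<in> sets ?L" by simp
      then have A'[measurable]: "A \<in> sets (Pi\<^sub>M I (\<lambda>_. borel))" by (simp only: setsL)
      have c: "emeasure (cond h) (rvec I P -` A \<inter> space M) = (\<integral>\<^sup>+x. ennreal (\<psi> h x) * indicator A x \<partial>?L)"
        if h: "h \<in> {0, 1}" for h
      proof -
        have "emeasure (cond h) (rvec I P -` A \<inter> space M) =
            emeasure (distr (cond h) (Pi\<^sub>M I (\<lambda>_. borel)) (rvec I P)) A"
          using A' by (subst emeasure_distr) simp_all
        also have "\<dots> = (\<integral>\<^sup>+x. ennreal (\<psi> h x) * indicator A x \<partial>?L)"
          by (simp add: distr_rvec[OF h] dens[OF h] emeasure_density)
        finally show ?thesis .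
      qed
      have "emeasure (distr M ?L (rvec I P)) A = emeasure M (rvec I P -` A \<inter> space M)"
        by (simp add: emeasure_distr)
      also have "\<dots> = (\<integral>\<^sup>+x. ennreal (1/2) * (ennreal (\<psi> 0 x) * indicator A x) +
          ennreal (1/2) * (ennreal (\<psi> 1 x) * indicator A x) \<partial>?L)"
        by (subst emeasure_mixture) (simp_all add: c nn_integral_add nn_integral_cmult)
      also have "\<dots> = (\<integral>\<^sup>+x. ennreal (\<phi> x) * indicator A x \<partial>?L)"
        by (intro nn_integral_cong) (simp only: ennreal_\<phi> distrib_right mult.assoc)
      also have "\<dots> = emeasure (density ?L (\<lambda>x. ennreal (\<phi> x))) A"
        by (simp add: emeasure_density \<phi>_def)
      finally show "emeasure (distr M ?L (rvec I P)) A = emeasure (density ?L (\<lambda>x. ennreal (\<phi> x))) A" .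
    qed simp
  qed (simp_all add: \<phi>_def)
qed

section \<open>Positive dependence\<close>

text \<open>The probability, given \<open>H = h\<close>, that a null p-value lies on side
  \<open>t\<close> of \<open>1/2\<close>, with \<open>True\<close> for the lower side; the symmetry
  of the two null densities turns \<open>h\<close> into \<open>1 - h\<close> on the upper side. As
  \<open>H\<close> is fair and both sides have mass \<open>1/2\<close>, it is also the posterior
  probability of \<open>H = h\<close> given side \<open>t\<close>.\<close>

definition side_prob :: "bool \<Rightarrow> nat \<Rightarrow> real" where
  "side_prob t h = null_prob \<epsilon> (if t then h else 1 - h)"

lemma side_prob_simps:
  "side_prob True 0 = 1 - \<epsilon>" "side_prob True 1 = \<epsilon>" "side_prob True (Suc 0) = \<epsilon>"
  "side_prob False 0 = \<epsilon>" "side_prob False 1 = 1 - \<epsilon>" "side_prob False (Suc 0) = 1 - \<epsilon>"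
  by (simp_all add: side_prob_def null_prob_def)

text \<open>Both halves leave out \<open>1/2\<close>, where the null densities are \<open>0\<close>;
  \<open>null_density_half\<close> is thereby an identity at every point and not only almost
  everywhere.\<close>

definition half :: "bool \<Rightarrow> real set" where
  "half t = (if t then {0<..<1/2} else {1/2<..<1})"

lemma half_measurable[measurable]: "half t \<in> sets borel"
  by (simp add: half_def)

lemma emeasure_half: "emeasure lborel (half t) = ennreal (1/2)"
  by (simp add: half_def del: ennreal_half)

lemma null_density_half:
  assumes "h \<in> {0, 1}"
  shows "ennreal (null_density \<epsilon> h u) = ennreal (side_prob True h) * (2 * indicator (half True) u) +
    ennreal (side_prob False h) * (2 * indicator (half False) u)"
proof -
  have e: "ennreal (2 * c) = ennreal c * 2" if "0 \<le> c" for c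
    using that by (subst mult.commute) (simp add: ennreal_mult)
  show ?thesis
    using assms eps e[of \<epsilon>] e[of "1 - \<epsilon>"]
    by (auto simp: null_density_def null_density0_def side_prob_simps half_def indicator_def)
qed

lemma null_density_on_side:
  assumes "h \<in> {0, 1}"
  shows "ennreal (null_density \<epsilon> h u) * indicator {u. (u < 1/2) = t} u =
    ennreal (side_prob t h) * (2 * indicator (half t) u)"
  unfolding null_density_half[OF assms] by (cases t) (auto simp: half_def indicator_def)

text \<open>Only the null marginals depend on \<open>h\<close>. They mix the uniform laws on the two
  halves; for increasing \<open>g\<close> the mean over the lower half is at most
  \<open>g (1/2)\<close>, which is at most the mean over the upper half, and \<open>H = 1\<close>
  gives the upper half more weight.\<close>

lemma marginal_stochastic_mono:
  assumes [measurable]: "g \<in> borel_measurable borel" and "mono g"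
  shows "(\<integral>\<^sup>+u. g u \<partial>marginal 0 i) \<le> (\<integral>\<^sup>+u. g u \<partial>marginal 1 i)"
proof (cases "i \<in> H0")
  case False
  then show ?thesis by (simp add: marginal_def dens_def)
next
  case True
  define G where "G t = (\<integral>\<^sup>+u. 2 * indicator (half t) u * g u \<partial>lborel)" for t
  have G: "(\<integral>\<^sup>+u. g u \<partial>marginal h i) = ennreal (side_prob True h) * G True + ennreal (side_prob False h) * G False"
    if h: "h \<in> {0, 1}" for h
  proof -
    have "(\<integral>\<^sup>+u. g u \<partial>marginal h i) = (\<integral>\<^sup>+u. ennreal (null_density \<epsilon> h u) * g u \<partial>lborel)"
      unfolding marginal_def using True by (subst nn_integral_density) (auto simp: dens_def)
    also have "\<dots> = (\<integral>\<^sup>+u. ennreal (side_prob True h) * (2 * indicator (half True) u * g u) +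
        ennreal (side_prob False h) * (2 * indicator (half False) u * g u) \<partial>lborel)"
      unfolding null_density_half[OF h] by (simp only: distrib_right mult.assoc)
    also have "\<dots> = ennreal (side_prob True h) * G True + ennreal (side_prob False h) * G False"
      unfolding G_def by (simp add: nn_integral_add nn_integral_cmult)
    finally show ?thesis .
  qed
  have const: "(\<integral>\<^sup>+u. 2 * indicator (half t) u * c \<partial>lborel) = c" for t c
  proof -
    have "(\<integral>\<^sup>+u. 2 * indicator (half t) u * c \<partial>lborel) = (\<integral>\<^sup>+u. (2 * c) * indicator (half t) u \<partial>lborel)"
      by (simp only: ac_simps)
    also have "\<dots> = (2 * c) * ennreal (1/2)"
      by (subst nn_integral_cmult_indicator) (simp_all only: emeasure_half sets_lborel half_measurable)
    also have "\<dots> = c * (ennreal 2 * ennreal (1/2))" by (simp only: ac_simps ennreal_numeral)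
    also have "ennreal 2 * ennreal (1/2) = 1" by (subst ennreal_mult[symmetric]) auto
    finally show ?thesis by simp
  qed
  have "G True \<le> (\<integral>\<^sup>+u. 2 * indicator (half True) u * g (1/2) \<partial>lborel)"
    unfolding G_def using \<open>mono g\<close>
    by (intro nn_integral_mono) (auto simp: half_def indicator_def intro!: mult_left_mono monoD[of g])
  also have "\<dots> = (\<integral>\<^sup>+u. 2 * indicator (half False) u * g (1/2) \<partial>lborel)"
    by (simp only: const)
  also have "\<dots> \<le> G False"
    unfolding G_def using \<open>mono g\<close>
    by (intro nn_integral_mono) (auto simp: half_def indicator_def intro!: mult_left_mono monoD[of g])
  finally have "G True \<le> G False" .
  then show ?thesis
    using eps G[of 0] G[of 1] ennreal_mix_mono[of "G True" "G False" \<epsilon> "1 - \<epsilon>"]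
    by (simp add: side_prob_simps)
qed

text \<open>The law of the remaining coordinates given the side of \<open>1/2\<close> on which \<open>P i\<close> lies. As the null
  densities are constant on each side, this already determines the conditional law given \<open>P i\<close>.\<close>

definition rest_law :: "'i \<Rightarrow> bool \<Rightarrow> ('i \<Rightarrow> real) measure" where
  "rest_law i t = distr (uniform_measure M (P i -` {u. (u < 1/2) = t} \<inter> space M))
     (Pi\<^sub>M (I - {i}) (\<lambda>_. borel)) (rvec (I - {i}) P)"

text \<open>The law of the rest depends on \<open>u\<close> only through its side of
  \<open>1/2\<close>, with \<open>1/2\<close> itself on the upper side. It extends constantly
  outside \<open>(0,1)\<close>, so that monotonicity can hold on the whole line.\<close>

definition kernel :: "'i \<Rightarrow> real \<Rightarrow> ('i \<Rightarrow> real) measure" where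
  "kernel i u = distr (rest_law i (u < 1/2)) (Pi\<^sub>M I (\<lambda>_. borel)) (\<lambda>x. x(i := u))"

text \<open>Given \<open>H = h\<close> the other coordinates are independent of \<open>P i\<close>,
  so this is a version of the conditional probability of \<open>D\<close> given \<open>H = h\<close>
  and \<open>P i = u\<close>.\<close>

definition section_prob :: "'i \<Rightarrow> nat \<Rightarrow> ('i \<Rightarrow> real) set \<Rightarrow> real \<Rightarrow> ennreal" where
  "section_prob i h D u = (\<integral>\<^sup>+x. indicator D (x(i := u)) \<partial>Pi\<^sub>M (I - {i}) (marginal h))"

section \<open>The law of the vector given one null p-value\<close>

lemma side_measurable[measurable]: "{u::real. (u < 1/2) = t} \<in> sets borel"
  by measurable

lemma side_event_measurable:
  assumes i: "i \<in> I"
  shows "P i -` {u. (u < 1/2) = t} \<inter> space M \<in> events"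
  by (rule measurable_sets[OF P_meas[OF i] side_measurable])

lemma emeasure_side:
  assumes i: "i \<in> H0"
  shows "emeasure M (P i -` {u. (u < 1/2) = t} \<inter> space M) = ennreal (1/2)"
proof -
  have [simp]: "P i \<in> borel_measurable M" using P_meas i by simp
  have "emeasure M (P i -` {u. (u < 1/2) = t} \<inter> space M) =
      emeasure (distr M lborel (P i)) {u. (u < 1/2) = t}"
    by (rule emeasure_distr[symmetric]) simp_all
  also have "\<dots> = emeasure lborel ({0<..<1} \<inter> {u::real. (u < 1/2) = t})"
    unfolding distr_null_uniform[OF i] by (subst emeasure_uniform_measure) (simp_all add: divide_ennreal_def)
  also have "{0<..<1} \<inter> {u::real. (u < 1/2) = t} = (if t then {0<..<1/2} else {1/2..<1::real})"
    by auto
  also have "emeasure lborel \<dots> = ennreal (1/2)" by (simp del: ennreal_half)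
  finally show ?thesis .
qed

lemma prob_space_rest_law:
  assumes i: "i \<in> H0"
  shows "prob_space (rest_law i t)"
proof -
  interpret U: prob_space "uniform_measure M (P i -` {u. (u < 1/2) = t} \<inter> space M)"
    by (rule prob_space_uniform_measure) (simp_all only: emeasure_side[OF i], simp_all)
  have [measurable]: "rvec (I - {i}) P \<in> M \<rightarrow>\<^sub>M Pi\<^sub>M (I - {i}) (\<lambda>_. borel)" by (rule rvec_meas) auto
  show ?thesis unfolding rest_law_def by (rule U.prob_space_distr) simp
qed

text \<open>Bayes' rule. Given \<open>H\<close>, the side of \<open>P i\<close> and the other
  coordinates are independent. The prior mass \<open>1/2\<close> of \<open>H = h\<close> cancels
  against the mass \<open>1/2\<close> of the side, so the posterior weights are
  \<open>side_prob t h\<close> without further normalisation.\<close>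

lemma emeasure_rest_law:
  assumes i: "i \<in> H0" and E[measurable]: "E \<in> sets (Pi\<^sub>M (I - {i}) (\<lambda>_. borel))"
  shows "emeasure (rest_law i t) E =
    ennreal (side_prob t 0) * emeasure (Pi\<^sub>M (I - {i}) (marginal 0)) E +
    ennreal (side_prob t 1) * emeasure (Pi\<^sub>M (I - {i}) (marginal 1)) E"
proof -
  let ?J = "I - {i}"
  let ?S = "{u::real. (u < 1/2) = t}"
  let ?A = "P i -` ?S \<inter> space M" and ?B = "rvec ?J P -` E \<inter> space M"
  have iI: "i \<in> I" using i by simp
  have rv: "rvec ?J P \<in> M \<rightarrow>\<^sub>M Pi\<^sub>M ?J (\<lambda>_. borel)" by (rule rvec_meas) auto
  note [measurable] = side_event_measurable[OF iI, of t] measurable_sets[OF rv E]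
  define f where "f x = indicator ?S (x i) * (indicator E (restrict x ?J) :: ennreal)" for x
  have [measurable]: "(\<lambda>x. restrict x ?J) \<in> Pi\<^sub>M I (\<lambda>_. borel :: real measure) \<rightarrow>\<^sub>M Pi\<^sub>M ?J (\<lambda>_. borel)"
    by (rule measurable_restrict_subset) auto
  have f: "f \<in> borel_measurable (Pi\<^sub>M I (\<lambda>_. borel))"
    unfolding f_def[abs_def] using iI by measurable
  have rest: "restrict (rvec I P \<omega>) ?J = rvec ?J P \<omega>" for \<omega>
    by (auto simp: rvec_def restrict_def)
  have rvi: "rvec I P \<omega> i = P i \<omega>" for \<omega> using i by (simp add: rvec_def)
  have joint: "emeasure (cond h) (?A \<inter> ?B) = ennreal (side_prob t h) * emeasure (Pi\<^sub>M ?J (marginal h)) E"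
    if h: "h \<in> {0, 1}" for h
  proof -
    let ?m = "emeasure (Pi\<^sub>M ?J (marginal h)) E"
    have [measurable]: "E \<in> sets (Pi\<^sub>M ?J (marginal h))" using E by (simp only: sets_PiM_marginal)
    have "emeasure (cond h) (?A \<inter> ?B) = (\<integral>\<^sup>+\<omega>. indicator (?A \<inter> ?B) \<omega> \<partial>cond h)"
      using sets.Int[OF side_event_measurable[OF iI, of t] measurable_sets[OF rv E]]
      by (intro nn_integral_indicator[symmetric]) (simp only: sets_cond)
    also have "\<dots> = (\<integral>\<^sup>+\<omega>. f (rvec I P \<omega>) \<partial>cond h)"
      by (intro nn_integral_cong) (auto simp: f_def rest rvi indicator_def)
    also have "\<dots> = (\<integral>\<^sup>+u. ennreal (null_density \<epsilon> h u) * (\<integral>\<^sup>+x. f (x(i := u)) \<partial>Pi\<^sub>M ?J (marginal h)) \<partial>lborel)"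
      by (rule nn_integral_rvec_null[OF h i f])
    \<comment> \<open>The inner integral depends on \<open>u\<close> only through its side, and on
      side \<open>t\<close> within \<open>(0,1)\<close>, off \<open>1/2\<close>, the null density is
      the constant \<open>2 * side_prob t h\<close>.\<close>
    also have "\<dots> = (\<integral>\<^sup>+u. ennreal (side_prob t h) * ?m * 2 * indicator (half t) u \<partial>lborel)"
    proof (rule nn_integral_cong)
      fix u
      have "(\<integral>\<^sup>+x. f (x(i := u)) \<partial>Pi\<^sub>M ?J (marginal h)) =
          (\<integral>\<^sup>+x. indicator ?S u * indicator E x \<partial>Pi\<^sub>M ?J (marginal h))"
      proof (rule nn_integral_cong)
        fix x assume "x \<in> space (Pi\<^sub>M ?J (marginal h))"
        then have "restrict (x(i := u)) ?J = x"
          by (auto simp: space_PiM PiE_iff extensional_def restrict_def)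
        then show "f (x(i := u)) = indicator ?S u * indicator E x" by (simp add: f_def)
      qed
      also have "\<dots> = indicator ?S u * ?m" by (simp add: nn_integral_cmult)
      finally have "ennreal (null_density \<epsilon> h u) * (\<integral>\<^sup>+x. f (x(i := u)) \<partial>Pi\<^sub>M ?J (marginal h)) =
          (ennreal (null_density \<epsilon> h u) * indicator ?S u) * ?m" by (simp only: mult.assoc)
      then show "ennreal (null_density \<epsilon> h u) * (\<integral>\<^sup>+x. f (x(i := u)) \<partial>Pi\<^sub>M ?J (marginal h)) =
          ennreal (side_prob t h) * ?m * 2 * indicator (half t) u"
        unfolding null_density_on_side[OF h] by (simp only: ac_simps)
    qed
    also have "\<dots> = ennreal (side_prob t h) * ?m * 2 * ennreal (1/2)"
      by (subst nn_integral_cmult_indicator) (simp_all only: emeasure_half sets_lborel half_measurable)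
    also have "\<dots> = ennreal (side_prob t h) * ?m * (ennreal 2 * ennreal (1/2))"
      by (simp only: ac_simps ennreal_numeral)
    also have "ennreal 2 * ennreal (1/2) = 1" by (subst ennreal_mult[symmetric]) auto
    finally show ?thesis by simp
  qed
  have "emeasure (rest_law i t) E = emeasure (uniform_measure M ?A) ?B"
    unfolding rest_law_def using rv by (subst emeasure_distr) simp_all
  also have "\<dots> = emeasure M (?A \<inter> ?B) / ennreal (1/2)"
    by (subst emeasure_uniform_measure) (simp_all only: emeasure_side[OF i] side_event_measurable[OF iI] measurable_sets[OF rv E])
  also have "\<dots> = (ennreal (1/2) * (emeasure (cond 0) (?A \<inter> ?B) + emeasure (cond 1) (?A \<inter> ?B))) / ennreal (1/2)"
    by (subst emeasure_mixture) (simp_all only: distrib_left, measurable)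
  also have "\<dots> = emeasure (cond 0) (?A \<inter> ?B) + emeasure (cond 1) (?A \<inter> ?B)"
    by (subst mult.commute) (simp add: mult_divide_eq_ennreal)
  finally show ?thesis using joint[of 0] joint[of 1] by simp
qed

lemma kernel_measurable:
  assumes i: "i \<in> H0"
  shows "kernel i \<in> borel \<rightarrow>\<^sub>M prob_algebra (Pi\<^sub>M I (\<lambda>_. borel))"
proof -
  have "(\<lambda>u. distr (rest_law i t) (Pi\<^sub>M I (\<lambda>_. borel)) (\<lambda>x. x(i := u)))
      \<in> borel \<rightarrow>\<^sub>M prob_algebra (Pi\<^sub>M I (\<lambda>_. borel))" for t
  proof (rule measurable_distr_prob_space2)
    show "(\<lambda>_. rest_law i t) \<in> borel \<rightarrow>\<^sub>M prob_algebra (Pi\<^sub>M (I - {i}) (\<lambda>_. borel))"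
      using prob_space_rest_law[OF i]
      by (intro measurable_const) (simp add: space_prob_algebra rest_law_def)
    show "(\<lambda>(u, x). x(i := u)) \<in> borel \<Otimes>\<^sub>M Pi\<^sub>M (I - {i}) (\<lambda>_. borel) \<rightarrow>\<^sub>M Pi\<^sub>M I (\<lambda>_. borel :: real measure)"
      using i by (intro measurable_fun_upd_index) simp
  qed
  note this[measurable]
  have "kernel i = (\<lambda>u. if u < 1/2 then distr (rest_law i True) (Pi\<^sub>M I (\<lambda>_. borel)) (\<lambda>x. x(i := u))
      else distr (rest_law i False) (Pi\<^sub>M I (\<lambda>_. borel)) (\<lambda>x. x(i := u)))"
    by (auto simp: kernel_def fun_eq_iff)
  then show ?thesis by simp
qed

text \<open>Evaluating the law of the remaining coordinates at the section of \<open>D\<close> at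
  \<open>u\<close> turns the kernel into the posterior mixture of the conditional laws given
  \<open>H\<close>.\<close>

lemma emeasure_kernel:
  assumes i: "i \<in> H0" and D[measurable]: "D \<in> sets (Pi\<^sub>M I (\<lambda>_. borel))"
  shows "emeasure (kernel i u) D = ennreal (side_prob (u < 1/2) 0) * section_prob i 0 D u +
    ennreal (side_prob (u < 1/2) 1) * section_prob i 1 D u"
proof -
  let ?J = "I - {i}"
  let ?E = "(\<lambda>x. x(i := u)) -` D \<inter> space (Pi\<^sub>M ?J (\<lambda>_. borel))"
  have upd: "(\<lambda>x. x(i := u)) \<in> Pi\<^sub>M ?J (\<lambda>_. borel) \<rightarrow>\<^sub>M Pi\<^sub>M I (\<lambda>_. borel :: real measure)"
    using measurable_Pair2[OF measurable_fun_upd_index[of i], of u] i by simp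
  have E: "?E \<in> sets (Pi\<^sub>M ?J (\<lambda>_. borel))" by (rule measurable_sets[OF upd D])
  have sets_rest: "sets (rest_law i t) = sets (Pi\<^sub>M ?J (\<lambda>_. borel))"
    and space_rest: "space (rest_law i t) = space (Pi\<^sub>M ?J (\<lambda>_. borel))" for t
    by (simp_all add: rest_law_def)
  have sec: "emeasure (Pi\<^sub>M ?J (marginal h)) ?E = section_prob i h D u" for h
  proof -
    have sp: "space (Pi\<^sub>M ?J (marginal h)) = space (Pi\<^sub>M ?J (\<lambda>_. borel))"
      by (rule sets_eq_imp_space_eq[OF sets_PiM_marginal])
    have "?E \<in> sets (Pi\<^sub>M ?J (marginal h))" using E by (simp only: sets_PiM_marginal)
    then have "emeasure (Pi\<^sub>M ?J (marginal h)) ?E = (\<integral>\<^sup>+x. indicator ?E x \<partial>Pi\<^sub>M ?J (marginal h))"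
      by (rule nn_integral_indicator[symmetric])
    also have "\<dots> = section_prob i h D u"
      unfolding section_prob_def by (intro nn_integral_cong) (auto simp: sp indicator_def)
    finally show ?thesis .
  qed
  have "emeasure (kernel i u) D = emeasure (rest_law i (u < 1/2)) ?E"
    unfolding kernel_def using upd D
    by (subst emeasure_distr) (simp_all add: space_rest measurable_cong_sets[OF sets_rest refl])
  then show ?thesis using emeasure_rest_law[OF i E, of "u < 1/2"] by (simp only: sec)
qed

text \<open>The first claim compares points, as raising coordinate \<open>i\<close> cannot leave
  \<open>D\<close>. The second compares laws: given \<open>H = 1\<close> the remaining coordinates
  dominate those given \<open>H = 0\<close>.\<close>

lemma section_prob_mono:
  assumes D: "increasing_event I D" and "u \<le> v" and i: "i \<in> I"
  shows "section_prob i h D u \<le> section_prob i h D v"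
    and "section_prob i 0 D u \<le> section_prob i 1 D u"
proof -
  let ?J = "I - {i}"
  have [measurable]: "D \<in> sets (Pi\<^sub>M I (\<lambda>_. borel))" using D by (simp add: increasing_event_def)
  \<comment> \<open>Coordinate \<open>i\<close> and the remaining coordinates may all move, so one
    inequality serves both claims.\<close>
  have ind: "(indicator D (x(i := a)) :: ennreal) \<le> indicator D (y(i := b))"
    if "x \<in> extensional ?J" "y \<in> extensional ?J" "\<And>j. j \<in> ?J \<Longrightarrow> x j \<le> y j" "a \<le> b" for x y a b
  proof (cases "x(i := a) \<in> D")
    case True
    have "y(i := b) \<in> space (Pi\<^sub>M I (\<lambda>_. borel))"
      using that(2) i by (auto simp: space_PiM PiE_iff extensional_def)
    moreover have "\<forall>j\<in>I. (x(i := a)) j \<le> (y(i := b)) j" using that by simp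
    ultimately have "y(i := b) \<in> D" using D True unfolding increasing_event_def by blast
    then show ?thesis by (simp add: indicator_def)
  qed simp
  show "section_prob i h D u \<le> section_prob i h D v"
    unfolding section_prob_def using \<open>u \<le> v\<close>
    by (intro nn_integral_mono ind) (auto simp: space_PiM PiE_iff)
  have upd: "(\<lambda>x. x(i := u)) \<in> Pi\<^sub>M ?J (\<lambda>_. borel) \<rightarrow>\<^sub>M Pi\<^sub>M I (\<lambda>_. borel :: real measure)"
    using measurable_Pair2[OF measurable_fun_upd_index[OF i], of u] by simp
  show "section_prob i 0 D u \<le> section_prob i 1 D u"
    unfolding section_prob_def
  proof (rule nn_integral_PiM_stochastic_mono)
    show "(\<lambda>x. indicator D (x(i := u))) \<in> borel_measurable (Pi\<^sub>M ?J (\<lambda>_. borel))"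
      by (rule measurable_compose[OF upd]) simp
  qed (use finite_I in \<open>auto intro!: prob_space_marginal marginal_stochastic_mono ind simp del: One_nat_def\<close>)
qed

text \<open>If \<open>u\<close> and \<open>v\<close> lie on the same side, the posterior weights
  agree and only the sections grow. If \<open>1/2\<close> separates them, the posterior weight of
  \<open>H = 1\<close> also rises from \<open>\<epsilon>\<close> to
  \<open>1 - \<epsilon>\<close>.\<close>

lemma kernel_mono:
  assumes i: "i \<in> H0" and D: "increasing_event I D"
  shows "mono (\<lambda>u. measure (kernel i u) D)"
proof (rule monoI)
  fix u v :: real assume "u \<le> v"
  have Dm: "D \<in> sets (Pi\<^sub>M I (\<lambda>_. borel))" using D by (simp add: increasing_event_def)
  have iI: "i \<in> I" using i by simp
  interpret K: prob_space "kernel i v"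
    using measurable_space[OF kernel_measurable[OF i], of v] by (simp add: space_prob_algebra)
  note sec = section_prob_mono[OF D _ iI]
  have same: "ennreal (side_prob t 0) * section_prob i 0 D u + ennreal (side_prob t 1) * section_prob i 1 D u
      \<le> ennreal (side_prob t 0) * section_prob i 0 D v + ennreal (side_prob t 1) * section_prob i 1 D v" for t
    using \<open>u \<le> v\<close> by (intro add_mono mult_left_mono sec) auto
  have "emeasure (kernel i u) D \<le> emeasure (kernel i v) D"
  proof (cases "(u < 1/2) = (v < 1/2)")
    case True
    then show ?thesis unfolding emeasure_kernel[OF i Dm] using same by simp
  next
    case False
    then have uv: "u < 1/2" "\<not> v < 1/2" using \<open>u \<le> v\<close> by auto
    \<comment> \<open>The passage from \<open>u\<close> to \<open>v\<close> takes two steps: weight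
      first moves to \<open>H = 1\<close> with the point kept at \<open>u\<close>, then the point
      moves to \<open>v\<close> under the weights of the upper side.\<close>
    have "ennreal (1 - \<epsilon>) * section_prob i 0 D u + ennreal \<epsilon> * section_prob i 1 D u
        \<le> ennreal \<epsilon> * section_prob i 0 D u + ennreal (1 - \<epsilon>) * section_prob i 1 D u"
      using eps by (intro ennreal_mix_mono sec(2)[OF order.refl]) auto
    also have "\<dots> \<le> ennreal \<epsilon> * section_prob i 0 D v + ennreal (1 - \<epsilon>) * section_prob i 1 D v"
      using same[of False] by (simp add: side_prob_simps)
    finally show ?thesis unfolding emeasure_kernel[OF i Dm] using uv by (simp add: side_prob_simps)
  qed
  then show "measure (kernel i u) D \<le> measure (kernel i v) D"
    unfolding measure_def by (rule enn2real_mono) (simp add: K.emeasure_eq_measure)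
qed

text \<open>A conditional expectation is determined by its integrals over the events
  \<open>P i \<in> B\<close>. After splitting over \<open>H\<close> and integrating
  \<open>P i\<close> last, both sides become integrals over \<open>u\<close> whose integrands agree
  at every \<open>u\<close>.\<close>

lemma cond_law_version_kernel:
  assumes i: "i \<in> H0"
  shows "cond_law_version M I P i (kernel i)"
  unfolding cond_law_version_def
proof (intro conjI ballI kernel_measurable[OF i])
  fix D assume D[measurable]: "D \<in> sets (Pi\<^sub>M I (\<lambda>_. borel :: real measure))"
  have iI: "i \<in> I" using i by simp
  let ?F = "vimage_algebra (space M) (P i) borel"
  let ?S = "{\<omega> \<in> space M. rvec I P \<omega> \<in> D}"
  note [measurable] = P_meas[OF iI] rvec_meas[OF order.refl]
  have sub: "subalgebra M ?F"
    unfolding subalgebra_def by (auto simp: sets_vimage_algebra2)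
  interpret finite_measure_subalgebra M ?F by standard (rule sub)
  have [measurable]: "P i \<in> borel_measurable ?F" by (rule measurable_vimage_algebra1) simp
  have Kprob: "prob_space (kernel i u)" for u
    using measurable_space[OF kernel_measurable[OF i], of u] by (simp add: space_prob_algebra)
  have emeasure_K: "emeasure (kernel i u) D = ennreal (measure (kernel i u) D)" for u
  proof -
    interpret K: prob_space "kernel i u" by (rule Kprob)
    show ?thesis by (rule K.emeasure_eq_measure)
  qed
  have K_le1: "measure (kernel i u) D \<le> 1" for u
    by (rule prob_space.prob_le_1[OF Kprob])
  have [measurable]: "(\<lambda>u. measure (kernel i u) D) \<in> borel_measurable borel"
    by (rule measurable_compose[OF measurable_prob_algebraD[OF kernel_measurable[OF i]] measurable_measure_subprob_algebra[OF D]])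
  have [measurable]: "(\<lambda>u. emeasure (kernel i u) D) \<in> borel_measurable borel"
    unfolding emeasure_K by measurable
  have [measurable]: "section_prob i h D \<in> borel_measurable borel" if "h \<in> {0, 1}" for h
    unfolding section_prob_def[abs_def] by (rule borel_measurable_section[OF that iI]) measurable
  \<comment> \<open>The nonnegative form lets the mixture and Fubini formulas apply without
    integrability conditions.\<close>
  have key: "(\<integral>\<^sup>+\<omega>. indicator B (P i \<omega>) * indicator D (rvec I P \<omega>) \<partial>M) =
      (\<integral>\<^sup>+\<omega>. indicator B (P i \<omega>) * emeasure (kernel i (P i \<omega>)) D \<partial>M)"
    if B[measurable]: "B \<in> sets borel" for B
  proof -
    let ?n = "\<lambda>h u. ennreal (null_density \<epsilon> h u)" and ?s = "\<lambda>h. section_prob i h D"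
    have rvi: "rvec I P \<omega> i = P i \<omega>" for \<omega> using i by (simp add: rvec_def)
    have L: "(\<integral>\<^sup>+\<omega>. indicator B (P i \<omega>) * indicator D (rvec I P \<omega>) \<partial>cond h) =
        (\<integral>\<^sup>+u. ?n h u * (indicator B u * ?s h u) \<partial>lborel)" if h: "h \<in> {0, 1}" for h
    proof -
      have f: "(\<lambda>x. indicator B (x i) * indicator D x :: ennreal) \<in> borel_measurable (Pi\<^sub>M I (\<lambda>_. borel))"
        using iI by measurable
      have "(\<integral>\<^sup>+x. indicator B u * indicator D (x(i := u)) \<partial>Pi\<^sub>M (I - {i}) (marginal h)) =
          indicator B u * ?s h u" for u
      proof (cases "u \<in> B")
        case True then show ?thesis by (simp add: section_prob_def)
      qed simp
      then show ?thesis
        using nn_integral_rvec_null[OF h i f] by (simp add: rvi)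
    qed
    have R: "(\<integral>\<^sup>+\<omega>. indicator B (P i \<omega>) * emeasure (kernel i (P i \<omega>)) D \<partial>cond h) =
        (\<integral>\<^sup>+u. ?n h u * (indicator B u * emeasure (kernel i u) D) \<partial>lborel)" if h: "h \<in> {0, 1}" for h
    proof -
      have f: "(\<lambda>x. indicator B (x i) * emeasure (kernel i (x i)) D) \<in> borel_measurable (Pi\<^sub>M I (\<lambda>_. borel))"
        using iI by measurable
      interpret R: prob_space "Pi\<^sub>M (I - {i}) (marginal h)"
        by (intro prob_space_PiM prob_space_marginal h)
      show ?thesis
        using nn_integral_rvec_null[OF h i f] by (simp add: rvi R.emeasure_space_1)
    qed
    \<comment> \<open>On either side, half the null density given \<open>H = h\<close> equals the
      posterior weight of \<open>h\<close>. The left side is therefore the mixture that gives the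
      kernel, and the right side agrees because the two weights add up to \<open>1\<close>.\<close>
    have pt: "ennreal (1/2) * (?n 0 u * (indicator B u * ?s 0 u)) + ennreal (1/2) * (?n 1 u * (indicator B u * ?s 1 u)) =
        ennreal (1/2) * (?n 0 u * (indicator B u * emeasure (kernel i u) D)) +
        ennreal (1/2) * (?n 1 u * (indicator B u * emeasure (kernel i u) D))" for u
    proof -
      have e: "ennreal (1/2) * ennreal (2 * c) = ennreal c" for c
        by (subst ennreal_mult'[symmetric]) auto
      have e': "ennreal (1/2) * (ennreal (2 * c) * x) = ennreal c * x" for c x
        by (simp only: mult.assoc[symmetric] e)
      have s: "ennreal \<epsilon> * x + ennreal (1 - \<epsilon>) * x = x" "ennreal (1 - \<epsilon>) * x + ennreal \<epsilon> * x = x" for x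
        using eps by (simp_all add: distrib_right[symmetric] ennreal_plus[symmetric] del: ennreal_plus)
      consider "0 < u" "u < 1/2" | "1/2 < u" "u < 1" | "u \<le> 0 \<or> u = 1/2 \<or> 1 \<le> u" by linarith
      then show ?thesis
      proof cases
        case 1
        then have n: "null_density \<epsilon> 0 u = 2 * (1 - \<epsilon>)" "null_density \<epsilon> 1 u = 2 * \<epsilon>"
          by (auto simp: null_density_def null_density0_def)
        have t: "(u < 1/2) = True" using 1 by simp
        show ?thesis unfolding n e' s emeasure_kernel[OF i D] t side_prob_simps
          by (cases "u \<in> B") simp_all
      next
        case 2
        then have n: "null_density \<epsilon> 0 u = 2 * \<epsilon>" "null_density \<epsilon> 1 u = 2 * (1 - \<epsilon>)"
          by (auto simp: null_density_def null_density0_def)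
        have t: "(u < 1/2) = False" using 2 by simp
        show ?thesis unfolding n e' s emeasure_kernel[OF i D] t side_prob_simps
          by (cases "u \<in> B") simp_all
      next
        \<comment> \<open>At \<open>1/2\<close> and outside \<open>(0,1)\<close> both null densities
          are \<open>0\<close>, so any value of the kernel is harmless.\<close>
        case 3
        then have n: "null_density \<epsilon> 0 u = 0" "null_density \<epsilon> 1 u = 0"
          by (auto simp: null_density_def null_density0_def)
        show ?thesis unfolding n by simp
      qed
    qed
    have "(\<integral>\<^sup>+\<omega>. indicator B (P i \<omega>) * indicator D (rvec I P \<omega>) \<partial>M) =
        (\<integral>\<^sup>+u. ennreal (1/2) * (?n 0 u * (indicator B u * ?s 0 u)) + ennreal (1/2) * (?n 1 u * (indicator B u * ?s 1 u)) \<partial>lborel)"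
      by (subst nn_integral_mixture) (simp_all add: L nn_integral_add nn_integral_cmult del: ennreal_half)
    also have "\<dots> = (\<integral>\<^sup>+u. ennreal (1/2) * (?n 0 u * (indicator B u * emeasure (kernel i u) D)) +
        ennreal (1/2) * (?n 1 u * (indicator B u * emeasure (kernel i u) D)) \<partial>lborel)"
      by (simp only: pt)
    also have "\<dots> = (\<integral>\<^sup>+\<omega>. indicator B (P i \<omega>) * emeasure (kernel i (P i \<omega>)) D \<partial>M)"
      by (subst nn_integral_mixture) (simp_all add: R nn_integral_add nn_integral_cmult del: ennreal_half)
    finally show ?thesis .
  qed
  show "AE \<omega> in M. real_cond_exp M ?F (indicator ?S) \<omega> = measure (kernel i (P i \<omega>)) D"
  proof (rule real_cond_exp_charact)
    fix A assume "A \<in> sets ?F"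
    then obtain B where B[measurable]: "B \<in> sets borel" and A: "A = P i -` B \<inter> space M"
      by (auto simp: sets_vimage_algebra2)
    have [measurable]: "A \<in> events" unfolding A by measurable
    have "(\<integral>\<omega>\<in>A. indicator ?S \<omega> \<partial>M) = enn2real (\<integral>\<^sup>+\<omega>. ennreal (indicator A \<omega> *\<^sub>R indicator ?S \<omega>) \<partial>M)"
      unfolding set_lebesgue_integral_def by (rule integral_eq_nn_integral) auto
    also have "(\<integral>\<^sup>+\<omega>. ennreal (indicator A \<omega> *\<^sub>R indicator ?S \<omega>) \<partial>M) =
        (\<integral>\<^sup>+\<omega>. indicator B (P i \<omega>) * indicator D (rvec I P \<omega>) \<partial>M)"
      by (intro nn_integral_cong) (auto simp: A indicator_def)
    also have "\<dots> = (\<integral>\<^sup>+\<omega>. ennreal (indicator A \<omega> *\<^sub>R measure (kernel i (P i \<omega>)) D) \<partial>M)"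
      unfolding key[OF B] emeasure_K by (intro nn_integral_cong) (auto simp: A indicator_def)
    also have "enn2real \<dots> = (\<integral>\<omega>\<in>A. measure (kernel i (P i \<omega>)) D \<partial>M)"
      unfolding set_lebesgue_integral_def by (rule integral_eq_nn_integral[symmetric]) auto
    finally show "(\<integral>\<omega>\<in>A. indicator ?S \<omega> \<partial>M) = (\<integral>\<omega>\<in>A. measure (kernel i (P i \<omega>)) D \<partial>M)" .
  next
    show "integrable M (\<lambda>\<omega>. measure (kernel i (P i \<omega>)) D)"
      by (rule integrable_const_bound[where B=1]) (auto simp: K_le1)
  qed (auto simp: integrable_real_indicator emeasure_eq_measure)
qed

lemma PRDS_nulls: "PRDS M I H0 P"
  unfolding PRDS_def using cond_law_version_kernel kernel_mono by blast

section \<open>Error and power bounds\<close>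

definition low_counts :: "'a \<Rightarrow> nat \<times> nat" where
  "low_counts \<omega> = (card {i\<in>H0. P i \<omega> < 1/2}, card {i\<in>H1. P i \<omega> < 1/2})"

lemma distr_low_counts:
  assumes h: "h \<in> {0, 1}"
  shows "distr (cond h) (count_space UNIV) low_counts = measure_pmf (counts_pmf (card H0) (card H1) \<epsilon> r h)"
proof -
  interpret C: prob_space "cond h" by (rule prob_space_cond[OF h])
  \<comment> \<open>A density equal to \<open>2 * c\<close> on the lower half gives mass
    \<open>c\<close> there; this form treats nulls and alternatives alike.\<close>
  have low: "C.prob {\<omega>\<in>space (cond h). P i \<omega> < 1/2} = c"
    if i: "i \<in> I" and c: "\<And>u. dens h i u * indicator {..<1/2} u = 2 * c * indicator {0<..<1/2} u" "0 \<le> c" for i c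
  proof -
    have [measurable]: "P i \<in> borel_measurable (cond h)"
      using P_meas[OF i] by (simp cong: measurable_cong_sets)
    have "emeasure (cond h) {\<omega>\<in>space (cond h). P i \<omega> < 1/2} = emeasure (distr (cond h) borel (P i)) {..<1/2}"
      by (subst emeasure_distr) (auto intro!: arg_cong2[where f=emeasure])
    also have "\<dots> = (\<integral>\<^sup>+u. ennreal (dens h i u) * indicator {..<1/2} u \<partial>lborel)"
      by (simp add: distr_P[OF h i] marginal_def emeasure_density)
    also have "\<dots> = (\<integral>\<^sup>+u. ennreal (2 * c) * indicator {0<..<1/2::real} u \<partial>lborel)"
    proof (rule nn_integral_cong)
      fix u
      show "ennreal (dens h i u) * indicator {..<1/2} u = ennreal (2 * c) * indicator {0<..<1/2} u"
        using c(1)[of u] by (auto simp: indicator_def split: if_splits)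
    qed
    also have "\<dots> = ennreal (2 * c) * ennreal (1/2)"
      by (subst nn_integral_cmult_indicator) (simp_all del: ennreal_half)
    also have "\<dots> = ennreal c" using c(2) by (subst ennreal_mult[symmetric]) auto
    finally show ?thesis using c(2) by (simp add: C.emeasure_eq_measure)
  qed
  have "distr (cond h) (count_space UNIV) (\<lambda>\<omega>. (card {i\<in>H0. P i \<omega> < 1/2}, card {i\<in>H1. P i \<omega> < 1/2})) =
      measure_pmf (pair_pmf (binomial_pmf (card H0) (null_prob \<epsilon> h)) (binomial_pmf (card H1) r))"
  proof (rule C.distr_counts_indep_indicators[OF fin disj])
    show "C.indep_vars (\<lambda>_. count_space UNIV) (\<lambda>i \<omega>. P i \<omega> < 1/2) I"
      by (rule C.indep_vars_compose2[OF indep[OF h]]) measurable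
    show "C.prob {\<omega> \<in> space (cond h). P i \<omega> < 1/2} = null_prob \<epsilon> h" if "i \<in> H0" for i
      using that h eps by (intro low)
        (auto simp: dens_def null_density_def null_density0_def null_prob_def indicator_def)
    show "C.prob {\<omega> \<in> space (cond h). P i \<omega> < 1/2} = r" if "i \<in> H1" for i
      using that disj r by (intro low) (auto simp: dens_def alt_density_def indicator_def)
  qed (use nonempty eps r in \<open>auto simp: null_prob_def\<close>)
  then show ?thesis unfolding low_counts_def[abs_def] counts_pmf_def .
qed

text \<open>The densities are \<open>0\<close> outside \<open>(0,1)\<close> and, by convention, at
  \<open>1/2\<close>. This supplies, almost surely, the premise of
  \<open>mirror_rejections_eq_low\<close> on the p-values.\<close>

lemma AE_cond_P:
  assumes h: "h \<in> {0, 1}"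
  shows "AE \<omega> in cond h. \<forall>i\<in>I. 0 < P i \<omega> \<and> P i \<omega> < 1 \<and> P i \<omega> \<noteq> 1/2"
proof (rule AE_finite_allI[OF finite_I])
  fix i assume i: "i \<in> I"
  have [measurable]: "P i \<in> borel_measurable (cond h)"
    using P_meas[OF i] by (simp cong: measurable_cong_sets)
  have m: "(\<lambda>u. ennreal (dens h i u)) \<in> borel_measurable lborel" by measurable
  have "AE u in marginal h i. 0 < u \<and> u < 1 \<and> u \<noteq> 1/2"
    unfolding marginal_def AE_density[OF m]
    by (auto simp: dens_def null_density_def null_density0_def alt_density_def intro!: AE_I2)
  then show "AE \<omega> in cond h. 0 < P i \<omega> \<and> P i \<omega> < 1 \<and> P i \<omega> \<noteq> 1/2"
    unfolding distr_P[OF h i, symmetric] by (subst (asm) AE_distr_iff) auto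
qed

lemma low_counts_measurable: "low_counts \<in> M \<rightarrow>\<^sub>M count_space UNIV"
proof -
  have "(\<lambda>\<omega>. card {i\<in>S. P i \<omega> < 1/2}) \<in> M \<rightarrow>\<^sub>M count_space UNIV" if S: "S \<subseteq> I" "finite S" for S
  proof -
    have "card {i\<in>S. P i \<omega> < 1/2} = (\<Sum>i\<in>S. if P i \<omega> < 1/2 then 1 else 0)" for \<omega>
      using S by (simp add: sum.If_cases Int_def)
    moreover have "(\<lambda>\<omega>. \<Sum>i\<in>S. if P i \<omega> < 1/2 then 1 else 0 :: nat) \<in> M \<rightarrow>\<^sub>M count_space UNIV"
      using S by (intro measurable_sum_nat) (auto intro!: measurable_If)
    ultimately show ?thesis by simp
  qed
  from this[of H0] this[of H1] show ?thesis
    unfolding low_counts_def[abs_def] using fin by measurable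
qed

text \<open>The argument shared by both bounds: domination outside a null event passes to
  expectations given each value of \<open>H\<close>, where the low counts are binomial, and then to
  their average. Values in \<open>[0,1]\<close> provide integrability.\<close>

lemma expectation_ge_counts:
  fixes f :: "'a \<Rightarrow> real" and G :: "nat \<times> nat \<Rightarrow> real"
  assumes f[measurable]: "f \<in> borel_measurable M" and f01: "\<And>\<omega>. 0 \<le> f \<omega>" "\<And>\<omega>. f \<omega> \<le> 1"
    and G01: "\<And>z. 0 \<le> G z" "\<And>z. G z \<le> 1"
    and le: "\<And>\<omega>. (\<And>i. i \<in> I \<Longrightarrow> 0 < P i \<omega> \<and> P i \<omega> < 1 \<and> P i \<omega> \<noteq> 1/2) \<Longrightarrow> G (low_counts \<omega>) \<le> f \<omega>"
  shows "1/2 * (\<Sum>h\<in>{0, 1}. measure_pmf.expectation (counts_pmf (card H0) (card H1) \<epsilon> r h) G) \<le> expectation f"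
proof -
  let ?E = "\<lambda>h. measure_pmf.expectation (counts_pmf (card H0) (card H1) \<epsilon> r h) G"
  have E0: "0 \<le> ?E h" for h by (rule integral_nonneg_AE) (simp add: G01)
  have c: "ennreal (?E h) \<le> (\<integral>\<^sup>+\<omega>. ennreal (f \<omega>) \<partial>cond h)" if h: "h \<in> {0, 1}" for h
  proof -
    have lm: "low_counts \<in> cond h \<rightarrow>\<^sub>M count_space UNIV"
      using low_counts_measurable by (simp cong: measurable_cong_sets)
    have "ennreal (?E h) = (\<integral>\<^sup>+z. ennreal (G z) \<partial>counts_pmf (card H0) (card H1) \<epsilon> r h)"
      using G01 by (intro nn_integral_eq_integral[symmetric] measure_pmf.integrable_const_bound[where B=1]) auto
    also have "\<dots> = (\<integral>\<^sup>+\<omega>. ennreal (G (low_counts \<omega>)) \<partial>cond h)"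
      unfolding distr_low_counts[OF h, symmetric] by (rule nn_integral_distr[OF lm]) simp
    also have "\<dots> \<le> (\<integral>\<^sup>+\<omega>. ennreal (f \<omega>) \<partial>cond h)"
    proof (rule nn_integral_mono_AE)
      show "AE \<omega> in cond h. ennreal (G (low_counts \<omega>)) \<le> ennreal (f \<omega>)"
        using AE_cond_P[OF h]
      proof eventually_elim
        case (elim \<omega>)
        then show ?case by (intro ennreal_leI le) blast
      qed
    qed
    finally show ?thesis .
  qed
  have "ennreal (1/2 * (\<Sum>h\<in>{0, 1}. ?E h)) = ennreal (1/2) * ennreal (?E 0) + ennreal (1/2) * ennreal (?E 1)"
    using E0 by (simp add: distrib_left ennreal_mult'[symmetric] ennreal_plus[symmetric] del: ennreal_half ennreal_plus)
  also have "\<dots> \<le> ennreal (1/2) * (\<integral>\<^sup>+\<omega>. ennreal (f \<omega>) \<partial>cond 0) + ennreal (1/2) * (\<integral>\<^sup>+\<omega>. ennreal (f \<omega>) \<partial>cond 1)"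
    by (intro add_mono mult_left_mono c) auto
  also have "\<dots> = (\<integral>\<^sup>+\<omega>. ennreal (f \<omega>) \<partial>M)"
    by (rule nn_integral_mixture[symmetric]) measurable
  also have "\<dots> = ennreal (expectation f)"
    using f01 by (intro nn_integral_eq_integral integrable_const_bound[where B=1]) auto
  finally show ?thesis
    using f01 by (subst (asm) ennreal_le_iff) (auto intro!: integral_nonneg_AE)
qed

section \<open>Bounds for the rejection set at level \<open>q\<close>\<close>

context
  fixes q :: real
  assumes q: "0 < q"
begin

abbreviation "Rej \<equiv> \<lambda>\<omega>. mirror_rejections I q (\<lambda>i. P i \<omega>)"

lemma card_Rej_measurable[measurable]: "(\<lambda>\<omega>. real (card (Rej \<omega> \<inter> J))) \<in> borel_measurable M"
proof (rule measurable_card_rejections[OF finite_I])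
  show "Rej \<omega> \<subseteq> I" for \<omega> by (auto simp: mirror_rejections_def)
  show "Measurable.pred M (\<lambda>\<omega>. i \<in> Rej \<omega>)" if "i \<in> I" for i
    by (rule measurable_mirror_rejections[OF finite_I P_meas that])
qed

lemma finite_Rej: "finite (Rej \<omega>)"
  using finite_I by (auto simp: mirror_rejections_def)

lemma Rej_counts:
  assumes P: "\<And>i. i \<in> I \<Longrightarrow> 0 < P i \<omega> \<and> P i \<omega> < 1 \<and> P i \<omega> \<noteq> 1/2"
    and x: "low_counts \<omega> = (x0, x1)" and crit: "int (x0 + x1) \<ge> crit_count (card H0 + card H1) q"
  shows "card (Rej \<omega> \<inter> H0) = x0" "card (Rej \<omega> \<inter> H1) = x1" "card (Rej \<omega>) = x0 + x1"
proof -
  let ?S = "\<lambda>J. {i\<in>J. P i \<omega> < 1/2}"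
  have split: "?S I = ?S H0 \<union> ?S H1" by auto
  have x01: "card (?S H0) = x0" "card (?S H1) = x1" using x by (simp_all add: low_counts_def)
  have card: "card (?S I) = x0 + x1"
    unfolding split x01[symmetric] using fin disj by (intro card_Un_disjoint) auto
  have m: "card I = card H0 + card H1" using fin disj by (rule card_Un_disjoint)
  have R: "Rej \<omega> = ?S I"
    using crit by (intro mirror_rejections_eq_low[OF finite_I q P]) (simp_all only: card m)
  show "card (Rej \<omega>) = x0 + x1" unfolding R by (rule card)
  have "?S I \<inter> H0 = ?S H0" "?S I \<inter> H1 = ?S H1" by auto
  then show "card (Rej \<omega> \<inter> H0) = x0" "card (Rej \<omega> \<inter> H1) = x1" unfolding R by (simp_all only: x01)
qed

lemma FDR_lower_bound:
  "1/2 * (\<Sum>h\<in>{0, 1}. measure_pmf.expectation (counts_pmf (card H0) (card H1) \<epsilon> r h)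
      (\<lambda>(x0, x1). real x0 / max (real (x0 + x1)) 1 * of_bool (int (x0 + x1) \<ge> crit_count (card H0 + card H1) q)))
    \<le> FDR M H0 Rej"
  unfolding FDR_def
proof (rule expectation_ge_counts)
  show "(\<lambda>\<omega>. real (card (Rej \<omega> \<inter> H0)) / max (real (card (Rej \<omega>))) 1) \<in> borel_measurable M"
    using card_Rej_measurable[of UNIV] by simp
  show "real (card (Rej \<omega> \<inter> H0)) / max (real (card (Rej \<omega>))) 1 \<le> 1" for \<omega>
    using card_mono[OF finite_Rej, of "Rej \<omega> \<inter> H0" \<omega>] by (simp add: divide_le_eq max_def)
  show "(case low_counts \<omega> of (x0, x1) \<Rightarrow> real x0 / max (real (x0 + x1)) 1 * of_bool (int (x0 + x1) \<ge> crit_count (card H0 + card H1) q))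
      \<le> real (card (Rej \<omega> \<inter> H0)) / max (real (card (Rej \<omega>))) 1"
    if P: "\<And>i. i \<in> I \<Longrightarrow> 0 < P i \<omega> \<and> P i \<omega> < 1 \<and> P i \<omega> \<noteq> 1/2" for \<omega>
  proof -
    obtain x0 x1 where x: "low_counts \<omega> = (x0, x1)" by (cases "low_counts \<omega>")
    \<comment> \<open>Below the critical count the function of the counts is \<open>0\<close> and
      nonnegativity of the ratio suffices; from the critical count on, the two sides are
      equal.\<close>
    show ?thesis using Rej_counts[OF P x]
      by (cases "int (x0 + x1) \<ge> crit_count (card H0 + card H1) q") (auto simp: x)
  qed
qed (auto simp: of_bool_def divide_le_eq max_def)

lemma Power_lower_bound:
  "1/2 * (\<Sum>h\<in>{0, 1}. measure_pmf.expectation (counts_pmf (card H0) (card H1) \<epsilon> r h)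
      (\<lambda>(x0, x1). real x1 / real (card H1) * of_bool (int (x0 + x1) \<ge> crit_count (card H0 + card H1) q)))
    \<le> Power M H1 Rej"
proof -
  let ?G = "\<lambda>(x0, x1). real x1 / real (card H1) * of_bool (int (x0 + x1) \<ge> crit_count (card H0 + card H1) q)"
  \<comment> \<open>The ratio is at most \<open>1\<close> only on the support of the binomial law.\<close>
  let ?G' = "\<lambda>z. min 1 (?G z)"
  have eq: "measure_pmf.expectation (counts_pmf (card H0) (card H1) \<epsilon> r h) ?G =
      measure_pmf.expectation (counts_pmf (card H0) (card H1) \<epsilon> r h) ?G'" if "h \<in> {0, 1}" for h
  proof (intro integral_cong_AE)
    have "set_pmf (binomial_pmf (card H1) r) \<subseteq> {..card H1}"
      using r by (auto simp: set_pmf_binomial_eq)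
    then have le: "real y / real (card H1) \<le> 1" if "y \<in> set_pmf (binomial_pmf (card H1) r)" for y
      using that by (auto simp: divide_le_eq)
    show "AE z in measure_pmf (counts_pmf (card H0) (card H1) \<epsilon> r h). ?G z = ?G' z"
      by (auto simp: AE_measure_pmf_iff counts_pmf_def of_bool_def dest: le)
  qed auto
  have "1/2 * (\<Sum>h\<in>{0, 1}. measure_pmf.expectation (counts_pmf (card H0) (card H1) \<epsilon> r h) ?G')
      \<le> Power M H1 Rej"
    unfolding Power_def
  proof (rule expectation_ge_counts)
    show "(\<lambda>\<omega>. real (card (Rej \<omega> \<inter> H1)) / real (card H1)) \<in> borel_measurable M"
      by measurable
    show "real (card (Rej \<omega> \<inter> H1)) / real (card H1) \<le> 1" for \<omega>
      using card_mono[OF fin(2), of "Rej \<omega> \<inter> H1"] by (simp add: divide_le_eq)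
    show "?G' (low_counts \<omega>) \<le> real (card (Rej \<omega> \<inter> H1)) / real (card H1)"
      if P: "\<And>i. i \<in> I \<Longrightarrow> 0 < P i \<omega> \<and> P i \<omega> < 1 \<and> P i \<omega> \<noteq> 1/2" for \<omega>
    proof -
      obtain x0 x1 where x: "low_counts \<omega> = (x0, x1)" by (cases "low_counts \<omega>")
      show ?thesis using Rej_counts[OF P x]
        by (cases "int (x0 + x1) \<ge> crit_count (card H0 + card H1) q") (auto simp: x)
    qed
  qed auto
  then show ?thesis by (simp only: sum.cong[OF refl eq])
qed

end

end

theorem proposition5:
  fixes M :: "'a measure" and H :: "'a \<Rightarrow> nat" and P :: "'i \<Rightarrow> 'a \<Rightarrow> real"
    and H0 H1 :: "'i set" and n0 n1 m :: nat and q \<epsilon> r :: real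
  assumes q: "0 < q" "q < 1"
    and n: "1 \<le> n0" "1 \<le> n1" "m = n0 + n1"
    and eps: "0 < \<epsilon>" "\<epsilon> < 1/2"
    and r: "1/2 < r" "r < 1"
    and indices: "finite H0" "finite H1" "H0 \<inter> H1 = {}" "card H0 = n0" "card H1 = n1"
    and M: "prob_space M"
    and H_meas: "H \<in> M \<rightarrow>\<^sub>M count_space UNIV"
    and H_law: "distr M (count_space UNIV) H
                  = measure_pmf (map_pmf of_bool (bernoulli_pmf (1/2)))"
    and indep: "\<And>h. h \<in> {0, 1} \<Longrightarrow>
                  prob_space.indep_vars (given_eq M H h) (\<lambda>_. borel) P (H0 \<union> H1)"
    and nulls: "\<And>h i. h \<in> {0, 1} \<Longrightarrow> i \<in> H0 \<Longrightarrow>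
                  distributed (given_eq M H h) lborel (P i) (\<lambda>u. ennreal (null_density \<epsilon> h u))"
    and alts: "\<And>h i. h \<in> {0, 1} \<Longrightarrow> i \<in> H1 \<Longrightarrow>
                  distributed (given_eq M H h) lborel (P i) (\<lambda>u. ennreal (alt_density r u))"
  shows "(\<forall>i\<in>H0. distr M lborel (P i) = uniform_measure lborel {0<..<1}) \<and>
    (\<exists>\<phi>. distributed M (Pi\<^sub>M (H0 \<union> H1) (\<lambda>_. lborel)) (rvec (H0 \<union> H1) P) (\<lambda>x. ennreal (\<phi> x)) \<and>
         (\<forall>x\<in>(H0 \<union> H1) \<rightarrow>\<^sub>E {0<..<1}. 0 < \<phi> x)) \<and>
    PRDS M (H0 \<union> H1) H0 P \<and>
    FDR M H0 (\<lambda>\<omega>. mirror_rejections (H0 \<union> H1) q (\<lambda>i. P i \<omega>))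
      \<ge> 1/2 * (\<Sum>h\<in>{0, 1}. measure_pmf.expectation (counts_pmf n0 n1 \<epsilon> r h)
          (\<lambda>(x0, x1). real x0 / max (real (x0 + x1)) 1
              * of_bool (int (x0 + x1) \<ge> crit_count m q))) \<and>
    Power M H1 (\<lambda>\<omega>. mirror_rejections (H0 \<union> H1) q (\<lambda>i. P i \<omega>))
      \<ge> 1/2 * (\<Sum>h\<in>{0, 1}. measure_pmf.expectation (counts_pmf n0 n1 \<epsilon> r h)
          (\<lambda>(x0, x1). real x1 / real n1
              * of_bool (int (x0 + x1) \<ge> crit_count m q)))"
proof -
  \<comment> \<open>Sizes of at least \<open>1\<close> make both index sets nonempty, as the locale
    demands.\<close>
  interpret mirror_model M H P H0 H1 \<epsilon> r
    by (intro mirror_model.intro mirror_model_axioms.intro M)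
      (use n eps r indices H_meas H_law indep nulls alts in auto)
  have card: "card H0 = n0" "card H1 = n1" "n0 + n1 = m" using n indices by auto
  show ?thesis
    by (intro conjI ballI distr_null_uniform distributed_joint_positive PRDS_nulls
        FDR_lower_bound[OF q(1), unfolded card] Power_lower_bound[OF q(1), unfolded card])
qed

end
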